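(* Let $Z>0$ be a random variable with Laplace transform $\varphi$, let $\omega$ be an infinitely divisible characteristic function on $\mathbb{R}$, and let $h=\varphi\{-\log\omega\}$ be the characteristic function of the corresponding $\varphi$-mixture of an infinitely divisible law. Then, for every such $\varphi$-mixture, the characteristic function $h^t$ represents a stochastic process $\{X(T(t)),t>0\}$, given $X(0)=0$, that is subordinated to the process $\{X(s),s>0\}$ having stationary and independent increments with characteristic function $\omega^s$, by the directing process (operational time) $\{T(t),t>0\}$ with Laplace transform $\varphi^t$. That is, there exist a real-valued process $\{X(s)\}$ with stationary independent increments, $X(0)=0$ and $E[e^{iuX(s)}]=\omega(u)^s$ for all $s>0$, $u\in\mathbb{R}$, and a directing process $\{T(t)\}$ independent of $\{X(s)\}$ with $E[e^{-vT(t)}]=\varphi(v)^t$ for all $t>0$, $v\ge 0$, such that $E[e^{iuX(T(t))}]=h(u)^t$ for all $t>0$ and $u\in\mathbb{R}$.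
   Context: A characteristic function $\omega$ is infinitely divisible iff $\omega^s$ is a characteristic function for every $s>0$; then $\omega$ has no real zero, $\log\omega$ denotes its continuous logarithm with $\log\omega(0)=0$, and $\omega^s=\exp\{s\log\omega\}$. The Laplace transform $\varphi(v)=E[e^{-vZ}]$ is defined for complex $v$ with $\mathrm{Re}\,v\ge0$. The $\varphi$-mixture of the infinitely divisible law with characteristic function $\omega$ is the law with characteristic function $u\mapsto\varphi(-\log\omega(u))=\int_0^\infty \omega(u)^s\,dG(s)$, where $G$ is the distribution function of $Z$; it arises by randomizing the parameter $s$ in $\omega^s$ according to $G$. The symbols $h^t$ and $\varphi^t$ denote $t$-th powers of $h$ and $\varphi$. A directing process (operational time) is a process $\{T(t)\}$ with $T(0)=0$ and non-negative, stationary and independent increments; the process $\{X(T(t))\}$, with $\{T(t)\}$ independent of $\{X(s)\}$, is said to be subordinated to $\{X(s)\}$ with directing process $\{T(t)\}$.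
   Formalization: Z is additionally assumed infinitely divisible (φ^t is the Laplace transform of a law on [0,∞) for every t>0); the conclusion forces this, and it fails e.g. for Z uniform on (0,1). *)

theory Defs
  imports "HOL-Probability.Probability"
begin

definition cont_log :: "(real \<Rightarrow> complex) \<Rightarrow> real \<Rightarrow> complex" where
  "cont_log f = (THE L. continuous_on UNIV L \<and> L 0 = 0 \<and> (\<forall>u. exp (L u) = f u))"

lemma cont_log_unique:
  fixes K L :: "real \<Rightarrow> complex"
  assumes "continuous_on UNIV K" "K 0 = 0" "continuous_on UNIV L" "L 0 = 0"
    and eq: "\<And>u. exp (K u) = exp (L u)"
  shows "K = L"
proof -
  define d where "d = (\<lambda>u. K u - L u)"
  have ed: "exp (d u) = 1" for u
    using eq[of u] by (simp add: d_def exp_diff)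
  have "d constant_on UNIV"
  proof (rule continuous_discrete_range_constant)
    show "connected (UNIV :: real set)" by simp
    show "continuous_on UNIV d"
      unfolding d_def by (intro continuous_on_diff assms)
    show "\<exists>e>0. \<forall>y. y \<in> UNIV \<and> d y \<noteq> d x \<longrightarrow> e \<le> norm (d y - d x)" for x
    proof (intro exI[of _ "2 * pi"] conjI allI impI)
      fix y assume y: "y \<in> UNIV \<and> d y \<noteq> d x"
      have "exp (d y - d x) = 1" by (simp add: exp_diff ed)
      then obtain n :: int where n: "Re (d y - d x) = 0" "Im (d y - d x) = of_int (2 * n) * pi"
        by (auto simp only: exp_eq_1)
      with y have "n \<noteq> 0" by (auto simp: complex_eq_iff)
      then have "1 \<le> \<bar>real_of_int n\<bar>" by linarith
      then have "2 * pi \<le> \<bar>Im (d y - d x)\<bar>"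
        unfolding n(2) by (simp add: abs_mult)
      also have "\<dots> \<le> norm (d y - d x)" by (rule abs_Im_le_cmod)
      finally show "2 * pi \<le> norm (d y - d x)" .
    qed simp
  qed
  then have "d u = d 0" for u by (metis constant_on_def UNIV_I)
  then show ?thesis using assms by (auto simp: d_def fun_eq_iff)
qed

lemma cont_log_eqI:
  assumes "continuous_on UNIV L" "L 0 = 0" "\<And>u. exp (L u) = f u"
  shows "cont_log f = L"
  unfolding cont_log_def
  by (rule the_equality) (use assms cont_log_unique in auto)

lemma cont_log_props:
  assumes f: "continuous_on UNIV f" "f 0 = 1" "\<And>u. f u \<noteq> 0"
  shows "continuous_on UNIV (cont_log f)" "cont_log f 0 = 0" "exp (cont_log f u) = f u"
proof -
  obtain g where g: "continuous_on UNIV g" "\<And>u. f u = exp (g u)"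
    using continuous_logarithm_on_contractible[OF f(1)] f(3)
    by (metis UNIV_I contractible_UNIV)
  have "cont_log f = (\<lambda>u. g u - g 0)"
  proof (rule cont_log_eqI)
    show "continuous_on UNIV (\<lambda>u. g u - g 0)" by (intro continuous_intros g)
    show "exp (g u - g 0) = f u" for u
      using f(2) by (simp add: exp_diff flip: g(2))
  qed simp
  then show "continuous_on UNIV (cont_log f)" "cont_log f 0 = 0" "exp (cont_log f u) = f u"
    using f(2) by (auto intro!: continuous_intros g(1) simp: exp_diff simp flip: g(2))
qed

definition cf_power :: "(real \<Rightarrow> complex) \<Rightarrow> real \<Rightarrow> real \<Rightarrow> complex" where
  "cf_power f s u = exp (of_real s * cont_log f u)"

definition is_cf :: "(real \<Rightarrow> complex) \<Rightarrow> bool" where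
  "is_cf f \<longleftrightarrow> (\<exists>\<mu>. real_distribution \<mu> \<and> f = char \<mu>)"

text \<open>The absence of zeros is what gives the real powers in the last conjunct a meaning.\<close>

definition infinitely_divisible_cf :: "(real \<Rightarrow> complex) \<Rightarrow> bool" where
  "infinitely_divisible_cf \<omega> \<longleftrightarrow>
     is_cf \<omega> \<and> (\<forall>u. \<omega> u \<noteq> 0) \<and> (\<forall>s>0. is_cf (cf_power \<omega> s))"

definition laplace_transform :: "'a measure \<Rightarrow> ('a \<Rightarrow> real) \<Rightarrow> complex \<Rightarrow> complex" where
  "laplace_transform M Z v = (CLINT x|M. exp (- v * complex_of_real (Z x)))"

text \<open>For real \<open>v \<ge> 0\<close> the value of the Laplace transform of a non-negative random variable
  is a positive real number, so the principal branch in \<open>powr\<close> is the ordinary real power.\<close>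

definition infinitely_divisible_lt :: "(complex \<Rightarrow> complex) \<Rightarrow> bool" where
  "infinitely_divisible_lt \<phi> \<longleftrightarrow>
     (\<forall>t>0. \<exists>\<nu>. real_distribution \<nu> \<and> (AE z in \<nu>. 0 \<le> z) \<and>
        (\<forall>v\<ge>0. laplace_transform \<nu> (\<lambda>z. z) (complex_of_real v) =
                \<phi> (complex_of_real v) powr complex_of_real t))"

text \<open>Processes are families indexed by real time, of which only the part on \<open>[0, \<infinity>)\<close> is used.\<close>

definition stationary_independent_increments ::
    "'a measure \<Rightarrow> (real \<Rightarrow> 'a \<Rightarrow> real) \<Rightarrow> bool" where
  "stationary_independent_increments P X \<longleftrightarrow>
     (\<forall>t\<ge>0. X t \<in> borel_measurable P) \<and>
     (\<forall>t\<ge>0. \<forall>d\<ge>0. distr P borel (\<lambda>w. X (t + d) w - X t w) =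
                     distr P borel (\<lambda>w. X d w - X 0 w)) \<and>
     (\<forall>(n::nat) (\<tau> :: nat \<Rightarrow> real). 0 \<le> \<tau> 0 \<longrightarrow> (\<forall>i<n. \<tau> i \<le> \<tau> (Suc i)) \<longrightarrow>
        prob_space.indep_vars P (\<lambda>_. borel) (\<lambda>i w. X (\<tau> (Suc i)) w - X (\<tau> i) w) {..<n})"

definition directing_process :: "'a measure \<Rightarrow> (real \<Rightarrow> 'a \<Rightarrow> real) \<Rightarrow> bool" where
  "directing_process P T \<longleftrightarrow>
     stationary_independent_increments P T \<and>
     (\<forall>w\<in>space P. T 0 w = 0 \<and> (\<forall>s t. 0 \<le> s \<and> s \<le> t \<longrightarrow> 0 \<le> T t w - T s w))"

definition independent_processes ::
    "'a measure \<Rightarrow> (real \<Rightarrow> 'a \<Rightarrow> real) \<Rightarrow> (real \<Rightarrow> 'a \<Rightarrow> real) \<Rightarrow> bool" where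
  "independent_processes P X Y \<longleftrightarrow>
     prob_space.indep_var P
       (PiM {0..} (\<lambda>_. borel)) (\<lambda>w. \<lambda>t\<in>{0..}. X t w)
       (PiM {0..} (\<lambda>_. borel)) (\<lambda>w. \<lambda>t\<in>{0..}. Y t w)"

end

theory Submission
  imports Defs
begin

text \<open>
  The powers \<open>\<omega>\<^sup>s\<close> are the characteristic functions of a convolution semigroup \<open>\<mu>\<close>. A distribution on
  \<open>[0, \<infinity>)\<close> is determined by its Laplace transform on \<open>[0, \<infinity>)\<close>, so the laws \<open>\<nu> t\<close> with transform \<open>\<phi>\<^sup>t\<close>
  form a convolution semigroup as well. Kolmogorov's extension theorem turns each semigroup into a
  process with stationary independent increments, and both processes are placed on one product space.
  Convergence in probability along sufficiently sparse dyadic grids becomes almost sure convergence;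
  the limit is a modification of the process that is jointly measurable in time and path and, for the
  semigroup \<open>\<nu>\<close>, nondecreasing. Fubini's theorem then gives \<open>E[exp (iu X(T(t)))] = E[\<omega>(u) powr T(t)]\<close>,
  which is the Laplace transform \<open>H t u\<close> of \<open>\<nu> t\<close> at \<open>- log \<omega>(u)\<close>. In \<open>t\<close> this is a multiplicative
  semigroup tending to \<open>1\<close> at \<open>0\<close>, in \<open>u\<close> it is a characteristic function, and \<open>H 1 = h\<close>: hence it has no
  zeros and, first for rational \<open>t\<close> by uniqueness of continuous logarithms, equals \<open>h\<^sup>t\<close>.
\<close>

section \<open>Paths of a convolution semigroup\<close>

lemma (in prob_space) indep_vars_empty: "indep_vars M' X {}"
  by (simp add: indep_vars_def indep_sets_def)

text \<open>The product over no factors has the single point \<open>\<lambda>_. undefined\<close>,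
  so a probability measure on it is determined. This settles the degenerate case of
  \<open>distr_eq_PiM_if_indep\<close>.\<close>

lemma prob_space_PiM_empty_unique:
  assumes "prob_space N" "sets N = sets (PiM {} M)"
  shows "N = PiM {} M"
proof (rule measure_eqI)
  interpret prob_space N by fact
  have sp: "space N = {\<lambda>_. undefined}"
    using sets_eq_imp_space_eq[OF assms(2)] by (simp add: space_PiM)
  fix A assume "A \<in> sets N"
  then have "A \<subseteq> space N" by (rule sets.sets_into_space)
  then have "A = {} \<or> A = space N" using sp by auto
  moreover have "emeasure (PiM {} M) (space N) = 1"
    by (simp add: sp PiM_empty)
  ultimately show "emeasure N A = emeasure (PiM {} M) A"
    using emeasure_space_1 by auto
qed (fact assms)

lemma (in prob_space) distr_eq_PiM_if_indep:
  assumes "indep_vars M' X L" and "\<And>i. i \<in> L \<Longrightarrow> distr M (M' i) (X i) = N i"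
  shows "distr M (PiM L M') (\<lambda>x. \<lambda>i\<in>L. X i x) = PiM L N"
proof (cases "L = {}")
  case True
  have "distr M (PiM {} M') (\<lambda>x. \<lambda>i\<in>{}. X i x) = PiM {} N"
  proof (rule prob_space_PiM_empty_unique)
    show "prob_space (distr M (PiM {} M') (\<lambda>x. \<lambda>i\<in>{}. X i x))"
      by (intro prob_space_distr measurable_restrict) auto
  qed (simp add: PiM_empty)
  then show ?thesis using True by simp
next
  case False
  have rv: "random_variable (M' i) (X i)" if "i \<in> L" for i
    using assms(1) that by (auto simp: indep_vars_def)
  have "distr M (PiM L M') (\<lambda>x. \<lambda>i\<in>L. X i x) = PiM L (\<lambda>i. distr M (M' i) (X i))"
    using indep_vars_iff_distr_eq_PiM'[OF False rv] assms(1) by simp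
  also have "\<dots> = PiM L N" by (intro PiM_cong assms(2)) auto
  finally show ?thesis .
qed

lemma char_return_0 [simp]: "char (return borel 0) u = 1"
  by (simp add: char_def integral_return)

section \<open>Partial sums of increments over a finite set of times\<close>

definition previous :: "real set \<Rightarrow> real \<Rightarrow> real" where
  "previous J s = Max (insert 0 {r \<in> J. r < s})"

text \<open>For \<open>J\<close> inside \<open>{0<..}\<close>, \<open>x s\<close> is read as the
  increment over the gap from \<open>previous J s\<close> to \<open>s\<close>, the first gap
  starting at \<open>0\<close>; the sum is then the value at \<open>t\<close> of a path started at
  \<open>0\<close>.\<close>

definition cumulative :: "real set \<Rightarrow> (real \<Rightarrow> real) \<Rightarrow> real \<Rightarrow> real" where
  "cumulative J x t = (\<Sum>s | s \<in> J \<and> s \<le> t. x s)"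

lemma previous_in: "finite J \<Longrightarrow> previous J s \<in> insert 0 J"
  using Max_in[of "insert 0 {r \<in> J. r < s}"] by (auto simp: previous_def)

lemma previous_less: "finite J \<Longrightarrow> 0 < s \<Longrightarrow> previous J s < s"
  by (auto simp: previous_def)

lemma previous_ge: "finite J \<Longrightarrow> r \<in> J \<Longrightarrow> r < s \<Longrightarrow> r \<le> previous J s"
  by (auto simp: previous_def)

lemma cumulative_zero: "J \<subseteq> {0<..} \<Longrightarrow> cumulative J x 0 = 0"
  unfolding cumulative_def by (rule sum.neutral) auto

lemma cumulative_diff:
  assumes "finite J" "a \<le> b"
  shows "cumulative J x b - cumulative J x a = (\<Sum>s | s \<in> J \<and> a < s \<and> s \<le> b. x s)"
proof -
  have "{s \<in> J. s \<le> b} = {s \<in> J. s \<le> a} \<union> {s \<in> J. a < s \<and> s \<le> b}"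
    using assms by auto
  then have "cumulative J x b = cumulative J x a + (\<Sum>s | s \<in> J \<and> a < s \<and> s \<le> b. x s)"
    unfolding cumulative_def using assms(1) by (simp only:) (rule sum.union_disjoint, auto)
  then show ?thesis by simp
qed

text \<open>Only \<open>b\<close> itself lies in \<open>J\<close> between
  \<open>previous J b\<close> and \<open>b\<close>, so the last summand can be split off; the
  induction is on the number of times below \<open>b\<close>. With \<open>g\<close> the identity the
  lemma adds up gap lengths, with \<open>g\<close> a path it recovers the path from its
  increments.\<close>

lemma cumulative_telescope:
  assumes J: "finite J" "J \<subseteq> {0<..}" and b: "b \<in> insert 0 J"
  shows "cumulative J (\<lambda>s. g s - g (previous J s)) b = g b - g 0"
  using b
proof (induction "card {s \<in> J. s < b}" arbitrary: b rule: less_induct)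
  case less
  show ?case
  proof (cases "b = 0")
    case True
    then show ?thesis using J by (simp add: cumulative_zero)
  next
    case False
    with less.prems J have b: "b \<in> J" "0 < b" by auto
    let ?p = "previous J b"
    have p: "?p < b" "?p \<in> insert 0 J"
      using previous_less[OF J(1) b(2)] previous_in[OF J(1)] by auto
    have "{s \<in> J. ?p < s \<and> s \<le> b} = {b}"
      using previous_ge[OF J(1)] b p by (force simp: not_less[symmetric])
    then have "cumulative J (\<lambda>s. g s - g (previous J s)) b
        - cumulative J (\<lambda>s. g s - g (previous J s)) ?p = g b - g ?p"
      using p by (subst cumulative_diff[OF J(1)]) auto
    moreover have "cumulative J (\<lambda>s. g s - g (previous J s)) ?p = g ?p - g 0"
    proof (cases "?p = 0")
      case True
      then show ?thesis using J by (simp add: cumulative_zero)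
    next
      case False
      with p have "?p \<in> J" by auto
      with p have "{s \<in> J. s < ?p} \<subset> {s \<in> J. s < b}" by auto
      then have "card {s \<in> J. s < ?p} < card {s \<in> J. s < b}"
        using J by (intro psubset_card_mono) auto
      then show ?thesis using less.hyps p by blast
    qed
    ultimately show ?thesis by simp
  qed
qed

section \<open>Convolution semigroups and their finite-dimensional laws\<close>

locale convolution_semigroup =
  fixes \<mu> :: "real \<Rightarrow> real measure"
  assumes real_distribution_law: "real_distribution (\<mu> s)"
    and law_0: "\<mu> 0 = return borel 0"
    and char_add: "0 \<le> s \<Longrightarrow> 0 \<le> t \<Longrightarrow> char (\<mu> (s + t)) u = char (\<mu> s) u * char (\<mu> t) u"
    and char_tendsto_1: "((\<lambda>s. char (\<mu> s) u) \<longlongrightarrow> 1) (at_right 0)"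
begin

lemma prob_space_law: "prob_space (\<mu> s)"
  using real_distribution_law[of s] by (simp add: real_distribution_def)

lemma sets_law [simp, measurable_cong]: "sets (\<mu> s) = sets borel"
  using real_distribution_law[of s]
  by (simp add: real_distribution_def real_distribution_axioms_def)

lemma sets_PiM_law: "sets (PiM J (\<lambda>i. \<mu> (f i))) = sets (PiM J (\<lambda>_. borel))"
  by (rule sets_PiM_cong) auto

lemma char_sum:
  assumes "finite K" "\<And>s. s \<in> K \<Longrightarrow> 0 \<le> f s"
  shows "char (\<mu> (\<Sum>s\<in>K. f s)) u = (\<Prod>s\<in>K. char (\<mu> (f s)) u)"
  using assms by (induction K) (auto simp: law_0 char_add sum_nonneg)

abbreviation increments_law :: "real set \<Rightarrow> (real \<Rightarrow> real) measure" where
  "increments_law J \<equiv> PiM J (\<lambda>s. \<mu> (s - previous J s))"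

text \<open>Disjoint intervals use disjoint blocks of the independent coordinates, which gives
  independence. On one block the characteristic functions multiply to that of \<open>\<mu>\<close>
  at the sum of the gap lengths, and these telescope to \<open>b i - a i\<close>.\<close>

lemma distr_increments:
  assumes J: "finite J" "J \<subseteq> {0<..}"
    and ab: "\<And>i. i \<in> L \<Longrightarrow> a i \<in> insert 0 J" "\<And>i. i \<in> L \<Longrightarrow> b i \<in> insert 0 J"
      "\<And>i. i \<in> L \<Longrightarrow> a i \<le> b i"
    and disj: "disjoint_family_on (\<lambda>i. {a i<..b i}) L"
  shows "distr (increments_law J) (PiM L (\<lambda>_. borel))
      (\<lambda>x. \<lambda>i\<in>L. cumulative J x (b i) - cumulative J x (a i)) = PiM L (\<lambda>i. \<mu> (b i - a i))"
proof -
  let ?Q = "increments_law J"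
  let ?K = "\<lambda>i. {s \<in> J. a i < s \<and> s \<le> b i}"
  interpret Q: prob_space ?Q by (intro prob_space_PiM prob_space_law)
  have comp: "distr ?Q borel (\<lambda>x. x s) = \<mu> (s - previous J s)" if "s \<in> J" for s
  proof -
    have "distr ?Q borel (\<lambda>x. x s) = distr ?Q (\<mu> (s - previous J s)) (\<lambda>x. x s)"
      by (intro distr_cong) auto
    also have "\<dots> = \<mu> (s - previous J s)"
      using that by (intro distr_PiM_component prob_space_law)
    finally show ?thesis .
  qed
  have ind: "Q.indep_vars (\<lambda>_. borel) (\<lambda>s x. x s) J"
  proof (cases "J = {}")
    case True
    then show ?thesis using Q.indep_vars_empty by simp
  next
    case False
    have "Q.indep_vars (\<lambda>_. borel) (\<lambda>s x. x s) J \<longleftrightarrow>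
      distr ?Q (PiM J (\<lambda>_. borel)) (\<lambda>x. \<lambda>i\<in>J. x i) = PiM J (\<lambda>i. distr ?Q borel (\<lambda>x. x i))"
      by (rule Q.indep_vars_iff_distr_eq_PiM'[OF False]) simp
    moreover have "distr ?Q (PiM J (\<lambda>_. borel)) (\<lambda>x. \<lambda>i\<in>J. x i) = distr ?Q ?Q (\<lambda>x. x)"
      by (rule distr_cong) (auto simp: space_PiM PiE_def extensional_restrict intro!: sets_PiM_cong)
    moreover have "PiM J (\<lambda>i. distr ?Q borel (\<lambda>x. x i)) = ?Q"
      by (rule PiM_cong) (auto simp: comp)
    ultimately show ?thesis by simp
  qed
  have "Q.indep_vars (\<lambda>j. PiM (?K j) (\<lambda>_. borel)) (\<lambda>j x. restrict (\<lambda>s. x s) (?K j)) L"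
    by (rule Q.indep_vars_restrict[OF ind]) (use disj in \<open>fastforce simp: disjoint_family_on_def disjoint_iff\<close>)+
  then have "Q.indep_vars (\<lambda>_. borel) (\<lambda>j x. \<Sum>s\<in>?K j. restrict (\<lambda>s. x s) (?K j) s) L"
    by (rule Q.indep_vars_compose2) measurable
  then have ind2: "Q.indep_vars (\<lambda>_. borel) (\<lambda>j x. cumulative J x (b j) - cumulative J x (a j)) L"
    by (rule Q.indep_vars_cong[THEN iffD1, rotated -1])
       (auto simp: cumulative_diff[OF J(1) ab(3)])
  show ?thesis
  proof (rule Q.distr_eq_PiM_if_indep[OF ind2])
    fix i assume i: "i \<in> L"
    have eq: "(\<lambda>x. cumulative J x (b i) - cumulative J x (a i)) = (\<lambda>x. \<Sum>s\<in>?K i. x s)"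
      by (auto simp: cumulative_diff[OF J(1) ab(3)[OF i]])
    show "distr ?Q borel (\<lambda>x. cumulative J x (b i) - cumulative J x (a i)) = \<mu> (b i - a i)"
    proof (rule Levy_uniqueness)
      show "real_distribution (distr ?Q borel (\<lambda>x. cumulative J x (b i) - cumulative J x (a i)))"
        unfolding eq by (intro Q.real_distribution_distr borel_measurable_sum) auto
      have sum: "(\<Sum>s\<in>?K i. s - previous J s) = b i - a i"
        using cumulative_diff[OF J(1) ab(3)[OF i], of "\<lambda>s. s - previous J s"]
          cumulative_telescope[OF J ab(1)[OF i], of "\<lambda>s. s"]
          cumulative_telescope[OF J ab(2)[OF i], of "\<lambda>s. s"] by simp
      show "char (distr ?Q borel (\<lambda>x. cumulative J x (b i) - cumulative J x (a i))) = char (\<mu> (b i - a i))"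
      proof
        fix u
        have "char (distr ?Q borel (\<lambda>x. \<Sum>s\<in>?K i. x s)) u
            = (\<Prod>s\<in>?K i. char (distr ?Q borel (\<lambda>x. x s)) u)"
          by (rule Q.char_distr_sum[OF Q.indep_vars_subset[OF ind]]) auto
        also have "\<dots> = (\<Prod>s\<in>?K i. char (\<mu> (s - previous J s)) u)"
          by (intro prod.cong) (auto simp: comp)
        also have "\<dots> = char (\<mu> (\<Sum>s\<in>?K i. s - previous J s)) u"
          using J previous_less[OF J(1)] by (intro char_sum[symmetric]) (auto intro: less_imp_le)
        finally show "char (distr ?Q borel (\<lambda>x. cumulative J x (b i) - cumulative J x (a i))) u
            = char (\<mu> (b i - a i)) u"
          by (simp add: eq sum)
      qed
    qed (rule real_distribution_law)
  qed
qed

definition finite_dim_law :: "real set \<Rightarrow> (real \<Rightarrow> real) measure" where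
  "finite_dim_law J = distr (increments_law J) (PiM J (\<lambda>_. borel)) (\<lambda>x. \<lambda>t\<in>J. cumulative J x t)"

lemma measurable_cumulative [measurable]:
  "(\<lambda>x. cumulative J x t) \<in> borel_measurable (PiM J (\<lambda>_. borel))"
  unfolding cumulative_def by measurable

lemma measurable_cumulative_law [measurable]:
  "(\<lambda>x. cumulative J x t) \<in> borel_measurable (increments_law J)"
  using measurable_cumulative by (simp cong: measurable_cong_sets add: sets_PiM_law)

lemma prob_space_finite_dim_law: "prob_space (finite_dim_law J)"
  unfolding finite_dim_law_def
  by (intro prob_space.prob_space_distr prob_space_PiM prob_space_law measurable_restrict) measurable

text \<open>Each gap of \<open>J\<close> is composed of gaps of the finer set \<open>H\<close>, so
  \<open>distr_increments\<close> produces the increments over \<open>J\<close> from those over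
  \<open>H\<close>. Their partial sums are again the values of the path built from
  \<open>H\<close>.\<close>

lemma finite_dim_law_projective:
  assumes "J \<subseteq> H" "finite H" "H \<subseteq> {0<..}"
  shows "finite_dim_law J = distr (finite_dim_law H) (PiM J (\<lambda>_. borel)) (\<lambda>f. restrict f J)"
proof -
  have J: "finite J" "J \<subseteq> {0<..}" using assms finite_subset by auto
  let ?y = "\<lambda>x. \<lambda>t\<in>J. cumulative H x t - cumulative H x (previous J t)"
  have "increments_law J = distr (increments_law H) (PiM J (\<lambda>_. borel)) ?y"
  proof (rule distr_increments[symmetric])
    show "finite H" "H \<subseteq> {0<..}" by fact+
    show "previous J i \<in> insert 0 H" if "i \<in> J" for i
      using previous_in[OF J(1), of i] assms by auto
    show "i \<in> insert 0 H" if "i \<in> J" for i using that assms by auto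
    show "previous J i \<le> i" if "i \<in> J" for i
      using previous_less[OF J(1), of i] that J by (auto intro: less_imp_le)
    have "{previous J m<..m} \<inter> {previous J n<..n} = {}" if "m \<in> J" "n \<in> J" "m < n" for m n
      using previous_ge[OF J(1) that(1) that(3)] by auto
    then show "disjoint_family_on (\<lambda>i. {previous J i<..i}) J"
      by (auto simp: disjoint_family_on_def) (metis (no_types, lifting) linorder_neqE_linordered_idom
        disjoint_iff greaterThanAtMost_iff)
  qed
  then have "finite_dim_law J = distr (distr (increments_law H) (PiM J (\<lambda>_. borel)) ?y)
     (PiM J (\<lambda>_. borel)) (\<lambda>x. \<lambda>t\<in>J. cumulative J x t)"
    by (simp add: finite_dim_law_def)
  also have "\<dots> = distr (increments_law H) (PiM J (\<lambda>_. borel)) ((\<lambda>x. \<lambda>t\<in>J. cumulative J x t) \<circ> ?y)"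
    by (intro distr_distr measurable_restrict) measurable
  also have "(\<lambda>x. \<lambda>t\<in>J. cumulative J x t) \<circ> ?y = (\<lambda>x. \<lambda>t\<in>J. cumulative H x t)"
  proof (intro ext)
    fix x t
    have "cumulative J (?y x) t = cumulative H x t" if "t \<in> J"
    proof -
      have "cumulative J (?y x) t = cumulative J (\<lambda>s. cumulative H x s - cumulative H x (previous J s)) t"
        unfolding cumulative_def by (intro sum.cong) auto
      also have "\<dots> = cumulative H x t"
        using cumulative_telescope[OF J, of t "cumulative H x"] that assms
        by (simp add: cumulative_zero)
      finally show ?thesis .
    qed
    then show "((\<lambda>x. \<lambda>t\<in>J. cumulative J x t) \<circ> ?y) x t = (\<lambda>t\<in>J. cumulative H x t) t"
      by (auto simp: restrict_def)
  qed
  also have "distr (increments_law H) (PiM J (\<lambda>_. borel)) (\<lambda>x. \<lambda>t\<in>J. cumulative H x t) =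
     distr (finite_dim_law H) (PiM J (\<lambda>_. borel)) (\<lambda>f. restrict f J)"
    unfolding finite_dim_law_def using assms(1)
    by (subst distr_distr)
       (auto intro!: measurable_restrict distr_cong measurable_restrict_subset simp: Int_absorb1)
  finally show ?thesis .
qed

text \<open>Kolmogorov's extension theorem enters here: \<open>path.lim\<close> is a measure on
  paths whose marginal on each finite set \<open>J\<close> of positive times is
  \<open>finite_dim_law J\<close>.\<close>

sublocale path: polish_projective "{0<..}" finite_dim_law
  unfolding polish_projective_def
  by (rule projective_family.intro) (rule finite_dim_law_projective prob_space_finite_dim_law; assumption)+

text \<open>Paths live on the index set \<open>{0<..}\<close>; the coordinate process is extended by \<open>0\<close>.\<close>

definition coordinate :: "real \<Rightarrow> (real \<Rightarrow> real) \<Rightarrow> real" where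
  "coordinate t w = (if 0 < t then w t else 0)"

lemma measurable_coordinate [measurable]: "coordinate t \<in> borel_measurable path.lim"
proof (cases "0 < t")
  case True
  then have "(\<lambda>w. w t) \<in> borel_measurable (PiM {0<..} (\<lambda>_. borel))" by simp
  then show ?thesis using True by (simp add: coordinate_def[abs_def] cong: measurable_cong_sets)
qed (simp add: coordinate_def[abs_def])

text \<open>The increments depend on finitely many coordinates only. On these the path law is
  \<open>finite_dim_law\<close>, itself an image of independent increments, and
  \<open>distr_increments\<close> applies.\<close>

lemma distr_path_increments:
  fixes n :: nat and \<tau> :: "nat \<Rightarrow> real"
  assumes \<tau>: "0 \<le> \<tau> 0" "\<And>i. i < n \<Longrightarrow> \<tau> i \<le> \<tau> (Suc i)"
  shows "distr path.lim (PiM {..<n} (\<lambda>_. borel))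
      (\<lambda>w. \<lambda>i\<in>{..<n}. coordinate (\<tau> (Suc i)) w - coordinate (\<tau> i) w)
    = PiM {..<n} (\<lambda>i. \<mu> (\<tau> (Suc i) - \<tau> i))"
proof -
  have mono: "\<tau> i \<le> \<tau> j" if "i \<le> j" "j \<le> n" for i j
    using that by (induction j) (auto simp: le_Suc_eq intro: order_trans[OF _ \<tau>(2)])
  have nn: "0 \<le> \<tau> i" if "i \<le> n" for i using \<tau>(1) mono[of 0 i] that by auto
  \<comment> \<open>Times may coincide or be \<open>0\<close>, hence the set of positive values. A
    repeated time gives an empty interval, with law \<open>\<mu> 0\<close>.\<close>
  define J where "J = \<tau> ` {..n} \<inter> {0<..}"
  have J: "finite J" "J \<subseteq> {0<..}" by (auto simp: J_def)
  have in_J: "\<tau> i \<in> insert 0 J" if "i \<le> n" for i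
    using nn[OF that] that by (auto simp: J_def)
  have lim_J: "distr path.lim (PiM J (\<lambda>_. borel)) (\<lambda>f. restrict f J) = finite_dim_law J"
  proof (rule measure_eqI)
    fix A assume "A \<in> sets (distr path.lim (PiM J (\<lambda>_. borel)) (\<lambda>f. restrict f J))"
    then have A: "A \<in> sets (PiM J (\<lambda>_. borel))" by simp
    have "emeasure (distr path.lim (PiM J (\<lambda>_. borel)) (\<lambda>f. restrict f J)) A
      = emeasure path.lim ((\<lambda>f. restrict f J) -` A \<inter> space path.lim)"
      using A J by (intro emeasure_distr) (auto intro!: measurable_restrict_subset cong: measurable_cong_sets)
    also have "\<dots> = emeasure path.lim (prod_emb {0<..} (\<lambda>_. borel) J A)"
      by (simp add: prod_emb_def space_PiM)
    also have "\<dots> = emeasure (finite_dim_law J) A"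
      using J A by (intro path.emeasure_lim_emb)
    finally show "emeasure (distr path.lim (PiM J (\<lambda>_. borel)) (\<lambda>f. restrict f J)) A
      = emeasure (finite_dim_law J) A" .
  qed (simp add: finite_dim_law_def)
  let ?inc = "\<lambda>w. \<lambda>i\<in>{..<n}. coordinate (\<tau> (Suc i)) w - coordinate (\<tau> i) w"
  have co: "coordinate (\<tau> i) \<in> borel_measurable (PiM J (\<lambda>_. borel))" if "i \<le> n" for i
    using in_J[OF that] J by (cases "\<tau> i = 0") (auto simp: coordinate_def[abs_def])
  have m: "?inc \<in> PiM J (\<lambda>_. borel) \<rightarrow>\<^sub>M PiM {..<n} (\<lambda>_. borel)"
    by (intro measurable_restrict borel_measurable_diff co) auto
  have "distr path.lim (PiM {..<n} (\<lambda>_. borel)) ?inc =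
     distr path.lim (PiM {..<n} (\<lambda>_. borel)) (?inc \<circ> (\<lambda>f. restrict f J))"
  proof (intro distr_cong refl, simp only: comp_def, rule restrict_ext)
    fix w i assume "i \<in> {..<n}"
    then have "\<tau> i \<in> insert 0 J" "\<tau> (Suc i) \<in> insert 0 J" by (intro in_J; simp)+
    then show "coordinate (\<tau> (Suc i)) w - coordinate (\<tau> i) w =
         coordinate (\<tau> (Suc i)) (restrict w J) - coordinate (\<tau> i) (restrict w J)"
      by (auto simp: coordinate_def)
  qed
  also have "\<dots> = distr (finite_dim_law J) (PiM {..<n} (\<lambda>_. borel)) ?inc"
    unfolding lim_J[symmetric] using J
    by (intro distr_distr[symmetric] m) (auto intro!: measurable_restrict_subset cong: measurable_cong_sets)
  also have "\<dots> = distr (increments_law J) (PiM {..<n} (\<lambda>_. borel)) (?inc \<circ> (\<lambda>x. \<lambda>t\<in>J. cumulative J x t))"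
    unfolding finite_dim_law_def by (intro distr_distr m measurable_restrict) measurable
  also have "\<dots> = distr (increments_law J) (PiM {..<n} (\<lambda>_. borel))
      (\<lambda>x. \<lambda>i\<in>{..<n}. cumulative J x (\<tau> (Suc i)) - cumulative J x (\<tau> i))"
  proof (intro distr_cong refl, simp only: comp_def, rule restrict_ext)
    fix x i assume "i \<in> {..<n}"
    then have "\<tau> i \<in> insert 0 J" "\<tau> (Suc i) \<in> insert 0 J" by (intro in_J; simp)+
    moreover have "coordinate t (\<lambda>t\<in>J. cumulative J x t) = cumulative J x t" if "t \<in> insert 0 J" for t
      using that J(2) cumulative_zero[OF J(2)] by (auto simp: coordinate_def)
    ultimately show "coordinate (\<tau> (Suc i)) (\<lambda>t\<in>J. cumulative J x t) - coordinate (\<tau> i) (\<lambda>t\<in>J. cumulative J x t)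
       = cumulative J x (\<tau> (Suc i)) - cumulative J x (\<tau> i)" by simp
  qed
  also have "\<dots> = PiM {..<n} (\<lambda>i. \<mu> (\<tau> (Suc i) - \<tau> i))"
  proof (rule distr_increments[OF J])
    have "{\<tau> i<..\<tau> (Suc i)} \<inter> {\<tau> j<..\<tau> (Suc j)} = {}" if "i < j" "j < n" for i j
      using mono[of "Suc i" j] that by auto
    then show "disjoint_family_on (\<lambda>i. {\<tau> i<..\<tau> (Suc i)}) {..<n}"
      unfolding disjoint_family_on_def by (metis Int_commute lessThan_iff linorder_neqE_nat)
  qed ((rule in_J \<tau>(2); simp)+)
  finally show ?thesis .
qed

end

section \<open>Measurable modifications\<close>

definition dyadic_floor :: "nat \<Rightarrow> real \<Rightarrow> real" where
  "dyadic_floor n t = of_int \<lfloor>t * 2 ^ n\<rfloor> / 2 ^ n"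

lemma dyadic_floor_le: "dyadic_floor n t \<le> t"
  by (simp add: dyadic_floor_def field_simps)

lemma dyadic_floor_ge: "t - 1 / 2 ^ n \<le> dyadic_floor n t"
proof -
  have "t - 1 / 2 ^ n = (t * 2 ^ n - 1) / 2 ^ n" by (simp add: diff_divide_distrib)
  also have "\<dots> \<le> dyadic_floor n t"
    unfolding dyadic_floor_def by (intro divide_right_mono) (linarith, simp)
  finally show ?thesis .
qed

lemma dyadic_floor_nonneg: "0 \<le> t \<Longrightarrow> 0 \<le> dyadic_floor n t"
  by (simp add: dyadic_floor_def)

lemma dyadic_floor_0: "dyadic_floor n 0 = 0"
  by (simp add: dyadic_floor_def)

lemma dyadic_floor_mono: "s \<le> t \<Longrightarrow> dyadic_floor n s \<le> dyadic_floor n t"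
  by (simp add: dyadic_floor_def divide_right_mono floor_mono mult_right_mono)

text \<open>The grid of level \<open>n\<close> is contained in that of level \<open>m\<close>:
  rescaled to level \<open>m\<close>, the coarse floor is still an integer not above
  \<open>t * 2 ^ m\<close>, hence not above the fine floor.\<close>

lemma dyadic_floor_refine:
  assumes "n \<le> m"
  shows "dyadic_floor n t \<le> dyadic_floor m t"
proof -
  obtain k where m: "m = n + k" using assms le_Suc_ex by blast
  have "of_int (\<lfloor>t * 2 ^ n\<rfloor> * 2 ^ k) \<le> t * 2 ^ m"
    by (simp add: m power_add mult.assoc[symmetric] mult_right_mono)
  then have "\<lfloor>t * 2 ^ n\<rfloor> * 2 ^ k \<le> \<lfloor>t * 2 ^ m\<rfloor>" by (simp only: le_floor_iff)
  then have "real_of_int (\<lfloor>t * 2 ^ n\<rfloor> * 2 ^ k) \<le> of_int \<lfloor>t * 2 ^ m\<rfloor>"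
    by (simp only: of_int_le_iff)
  then show ?thesis by (simp add: dyadic_floor_def m power_add field_simps)
qed

lemma dyadic_floor_Rats: "dyadic_floor n t \<in> \<rat>"
  by (simp add: dyadic_floor_def)

text \<open>The joint law along arbitrary time sequences carries everything: its components give the
  law of a single increment, and its product form is independence.\<close>

lemma (in prob_space) stationary_independent_incrementsI:
  fixes Y :: "real \<Rightarrow> 'a \<Rightarrow> real" and \<mu> :: "real \<Rightarrow> real measure"
  assumes meas: "\<And>t. 0 \<le> t \<Longrightarrow> Y t \<in> borel_measurable M"
    and prob: "\<And>s. prob_space (\<mu> s)" and sets: "\<And>s. sets (\<mu> s) = sets borel"
    and law: "\<And>(n::nat) \<tau>. 0 \<le> \<tau> 0 \<Longrightarrow> (\<And>i. i < n \<Longrightarrow> \<tau> i \<le> \<tau> (Suc i)) \<Longrightarrow>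
      distr M (PiM {..<n} (\<lambda>_. borel)) (\<lambda>w. \<lambda>i\<in>{..<n}. Y (\<tau> (Suc i)) w - Y (\<tau> i) w)
        = PiM {..<n} (\<lambda>i. \<mu> (\<tau> (Suc i) - \<tau> i))"
  shows "stationary_independent_increments M Y"
    and "0 \<le> t \<Longrightarrow> 0 \<le> d \<Longrightarrow> distr M borel (\<lambda>w. Y (t + d) w - Y t w) = \<mu> d"
proof -
  have comp: "distr M borel (\<lambda>w. Y (\<tau> (Suc j)) w - Y (\<tau> j) w) = \<mu> (\<tau> (Suc j) - \<tau> j)"
    if \<tau>: "0 \<le> \<tau> 0" "\<And>i. i < n \<Longrightarrow> \<tau> i \<le> \<tau> (Suc i)" and j: "j < n" for n :: nat and \<tau> j
  proof -
    have nn: "0 \<le> \<tau> i" if "i \<le> n" for i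
      using that by (induction i) (auto intro: \<tau> order_trans[OF _ \<tau>(2)])
    have "distr M borel (\<lambda>w. Y (\<tau> (Suc j)) w - Y (\<tau> j) w)
      = distr (distr M (PiM {..<n} (\<lambda>_. borel)) (\<lambda>w. \<lambda>i\<in>{..<n}. Y (\<tau> (Suc i)) w - Y (\<tau> i) w))
          borel (\<lambda>x. x j)"
      using j by (subst distr_distr)
        (auto intro!: measurable_restrict borel_measurable_diff meas nn distr_cong)
    also have "\<dots> = distr (PiM {..<n} (\<lambda>i. \<mu> (\<tau> (Suc i) - \<tau> i))) (\<mu> (\<tau> (Suc j) - \<tau> j)) (\<lambda>x. x j)"
      by (rule distr_cong[OF law[OF \<tau>]]) (auto simp: sets)
    also have "\<dots> = \<mu> (\<tau> (Suc j) - \<tau> j)"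
      using j by (intro distr_PiM_component prob) auto
    finally show ?thesis .
  qed
  have one: "distr M borel (\<lambda>w. Y (t + d) w - Y t w) = \<mu> d" if "0 \<le> t" "0 \<le> d" for t d
    \<comment> \<open>A single increment is the sequence with \<open>n = 1\<close>, running from
      \<open>t\<close> to \<open>t + d\<close>.\<close>
    using comp[of "\<lambda>i. if i = 0 then t else t + d" 1 0] that by simp
  then show "0 \<le> t \<Longrightarrow> 0 \<le> d \<Longrightarrow> distr M borel (\<lambda>w. Y (t + d) w - Y t w) = \<mu> d" .
  show "stationary_independent_increments M Y"
    unfolding stationary_independent_increments_def
  proof (intro conjI allI impI meas)
    fix t d :: real assume "0 \<le> t" "0 \<le> d"
    then show "distr M borel (\<lambda>w. Y (t + d) w - Y t w) = distr M borel (\<lambda>w. Y d w - Y 0 w)"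
      using one[of t d] one[of 0 d] by simp
  next
    fix n :: nat and \<tau> :: "nat \<Rightarrow> real"
    assume \<tau>: "0 \<le> \<tau> 0" "\<forall>i<n. \<tau> i \<le> \<tau> (Suc i)"
    have nn: "0 \<le> \<tau> i" if "i \<le> n" for i
      using that by (induction i) (use \<tau> in \<open>auto intro: order_trans[of _ "\<tau> _"]\<close>)
    show "indep_vars (\<lambda>_. borel) (\<lambda>i w. Y (\<tau> (Suc i)) w - Y (\<tau> i) w) {..<n}"
    proof (cases "n = 0")
      case True
      then show ?thesis by (simp add: indep_vars_empty)
    next
      case False
      have "indep_vars (\<lambda>_. borel) (\<lambda>i w. Y (\<tau> (Suc i)) w - Y (\<tau> i) w) {..<n} \<longleftrightarrow>
        distr M (PiM {..<n} (\<lambda>_. borel)) (\<lambda>w. \<lambda>i\<in>{..<n}. Y (\<tau> (Suc i)) w - Y (\<tau> i) w) =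
        PiM {..<n} (\<lambda>i. distr M borel (\<lambda>w. Y (\<tau> (Suc i)) w - Y (\<tau> i) w))"
        using False by (intro indep_vars_iff_distr_eq_PiM') (auto intro!: borel_measurable_diff meas nn)
      moreover have "PiM {..<n} (\<lambda>i. distr M borel (\<lambda>w. Y (\<tau> (Suc i)) w - Y (\<tau> i) w))
        = PiM {..<n} (\<lambda>i. \<mu> (\<tau> (Suc i) - \<tau> i))"
        using \<tau> by (intro PiM_cong refl comp[of \<tau> n]) auto
      ultimately show ?thesis using law[of \<tau> n] \<tau> by simp
    qed
  qed
qed

section \<open>Stochastic continuity and a jointly measurable modification\<close>

context convolution_semigroup
begin

text \<open>By Levy's continuity theorem \<open>char_tendsto_1\<close> means weak convergence to the
  point mass at \<open>0\<close>, which does not charge the boundary points \<open>-e\<close> and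
  \<open>e\<close>.\<close>

lemma law_concentrates_at_0:
  assumes "0 < e"
  shows "((\<lambda>s. measure (\<mu> s) {x. e < \<bar>x\<bar>}) \<longlongrightarrow> 0) (at_right 0)"
proof (rule tendsto_at_right_sequentially[where b = 1])
  fix S :: "nat \<Rightarrow> real"
  assume S: "\<And>n. 0 < S n" "S \<longlonglongrightarrow> 0"
  then have "filterlim S (at_right 0) sequentially"
    by (intro tendsto_imp_filterlim_at_right) auto
  then have "(\<lambda>n. char (\<mu> (S n)) u) \<longlonglongrightarrow> char (return borel 0) u" for u
    using filterlim_compose[OF char_tendsto_1] by simp
  moreover have ret: "real_distribution (return borel 0)"
    by (simp add: real_distribution_def real_distribution_axioms_def prob_space_return)
  ultimately have wc: "weak_conv_m (\<lambda>n. \<mu> (S n)) (return borel 0)"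
    by (intro levy_continuity real_distribution_law)
  let ?A = "{x :: real. e < \<bar>x\<bar>}"
  have A: "?A = - {-e..e}" by auto
  have "0 \<notin> frontier ?A"
    unfolding A frontier_complement using assms by (simp add: frontier_def)
  then have "emeasure (return borel 0) (frontier ?A) = 0"
    by (simp add: emeasure_return borel_closed)
  then have "(\<lambda>n. measure (\<mu> (S n)) ?A) \<longlonglongrightarrow> measure (return borel 0) ?A"
    by (intro weak_conv_imp_continuity_set_conv[OF real_distribution_law ret wc]) auto
  then show "(\<lambda>n. measure (\<mu> (S n)) ?A) \<longlonglongrightarrow> 0"
    using assms by (simp add: measure_return)
qed simp

lemma exists_levels:
  "\<exists>N :: nat \<Rightarrow> nat. mono N \<and> (\<forall>k s. 0 \<le> s \<longrightarrow> s \<le> 1 / 2 ^ N k \<longrightarrow>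
     measure (\<mu> s) {x. (1/2) ^ k < \<bar>x\<bar>} \<le> (1/2) ^ k)"
proof -
  have "\<exists>n :: nat. \<forall>s. 0 \<le> s \<longrightarrow> s \<le> 1 / 2 ^ n \<longrightarrow> measure (\<mu> s) {x. (1/2) ^ k < \<bar>x\<bar>} \<le> (1/2) ^ k" for k
  proof -
    have "eventually (\<lambda>s. measure (\<mu> s) {x. (1/2) ^ k < \<bar>x\<bar>} < (1/2) ^ k) (at_right 0)"
      by (rule order_tendstoD(2)[OF law_concentrates_at_0]) auto
    then obtain d where d: "0 < d" "\<And>s. 0 < s \<Longrightarrow> s < d \<Longrightarrow> measure (\<mu> s) {x. (1/2) ^ k < \<bar>x\<bar>} < (1/2) ^ k"
      unfolding eventually_at_right_field by auto
    obtain n where "(1/2::real) ^ n < d" using real_arch_pow_inv[OF d(1)] by force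
    then have n: "1 / 2 ^ n < d" by (simp add: power_one_over)
    have "measure (\<mu> s) {x. (1/2) ^ k < \<bar>x\<bar>} \<le> (1/2) ^ k" if "0 \<le> s" "s \<le> 1 / 2 ^ n" for s
    proof (cases "s = 0")
      case True
      then show ?thesis by (simp add: law_0 measure_return)
    qed (use that n d(2)[of s] in auto)
    then show ?thesis by blast
  qed
  then obtain n where n: "\<And>k s. 0 \<le> s \<Longrightarrow> s \<le> 1 / 2 ^ n k \<Longrightarrow>
     measure (\<mu> s) {x. (1/2) ^ k < \<bar>x\<bar>} \<le> (1/2) ^ k" by metis
  \<comment> \<open>Partial sums of the levels found for single \<open>k\<close> are monotone in
    \<open>k\<close>; a higher level only shrinks the range of admissible \<open>s\<close>.\<close>
  show ?thesis
  proof (intro exI[of _ "\<lambda>k. \<Sum>j\<le>k. n j"] conjI allI impI)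
    show "mono (\<lambda>k. \<Sum>j\<le>k. n j)" by (intro monoI sum_mono2) auto
    fix k s assume s: "0 \<le> s" "s \<le> 1 / (2::real) ^ (\<Sum>j\<le>k. n j)"
    have "n k \<le> (\<Sum>j\<le>k. n j)" by (intro member_le_sum) auto
    then have "1 / (2::real) ^ (\<Sum>j\<le>k. n j) \<le> 1 / 2 ^ n k"
      by (intro divide_left_mono power_increasing) auto
    then show "measure (\<mu> s) {x. (1/2) ^ k < \<bar>x\<bar>} \<le> (1/2) ^ k"
      using s by (intro n) auto
  qed
qed

text \<open>Grids so fine that the errors are summable in \<open>k\<close>, as the Borel-Cantelli lemma requires.\<close>

definition level :: "nat \<Rightarrow> nat" where
  "level = (SOME N. mono N \<and> (\<forall>k s. 0 \<le> s \<longrightarrow> s \<le> 1 / 2 ^ N k \<longrightarrow>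
     measure (\<mu> s) {x. (1/2) ^ k < \<bar>x\<bar>} \<le> (1/2) ^ k))"

lemma mono_level: "mono level"
  and level: "0 \<le> s \<Longrightarrow> s \<le> 1 / 2 ^ level k \<Longrightarrow> measure (\<mu> s) {x. (1/2) ^ k < \<bar>x\<bar>} \<le> (1/2) ^ k"
  using someI_ex[OF exists_levels] unfolding level_def[symmetric] by auto

text \<open>\<open>lim\<close> is total, so the value is unspecified where the sequence diverges.
  For each fixed \<open>t \<ge> 0\<close> this concerns a null set of paths only.\<close>

definition modification :: "real \<Rightarrow> (real \<Rightarrow> real) \<Rightarrow> real" where
  "modification t w = lim (\<lambda>k. coordinate (dyadic_floor (level k) t) w)"

lemma distr_path_increment:
  "0 \<le> t \<Longrightarrow> 0 \<le> d \<Longrightarrow> distr path.lim borel (\<lambda>w. coordinate (t + d) w - coordinate t w) = \<mu> d"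
  by (rule path.P.stationary_independent_incrementsI(2)[where \<mu> = \<mu>])
     (auto intro: prob_space_law distr_path_increments)

text \<open>The time error at stage \<open>k\<close> is at most \<open>1 / 2 ^ level k\<close>, so
  an error above \<open>(1/2) ^ k\<close> in the path value has probability at most
  \<open>(1/2) ^ k\<close>. Borel-Cantelli excludes infinitely many such errors.\<close>

lemma AE_coordinate_dyadic_tendsto:
  assumes t: "0 \<le> t"
  shows "AE w in path.lim. (\<lambda>k. coordinate (dyadic_floor (level k) t) w) \<longlonglongrightarrow> coordinate t w"
proof -
  let ?D = "\<lambda>k w. coordinate t w - coordinate (dyadic_floor (level k) t) w"
  let ?A = "\<lambda>k. {w \<in> space path.lim. (1/2) ^ k < \<bar>?D k w\<bar>}"
  have le: "measure path.lim (?A k) \<le> (1/2) ^ k" for k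
  proof -
    let ?q = "dyadic_floor (level k) t"
    have "measure path.lim (?A k) = measure (distr path.lim borel (?D k)) {x. (1/2) ^ k < \<bar>x\<bar>}"
      by (subst measure_distr) (auto intro!: arg_cong[where f = "measure path.lim"])
    also have "distr path.lim borel (?D k) = \<mu> (t - ?q)"
      using distr_path_increment[of ?q "t - ?q"] dyadic_floor_le[of "level k" t]
        dyadic_floor_nonneg[OF t] by simp
    also have "measure (\<mu> (t - ?q)) {x. (1/2) ^ k < \<bar>x\<bar>} \<le> (1/2) ^ k"
      using dyadic_floor_le[of "level k" t] dyadic_floor_ge[of t "level k"] by (intro level) auto
    finally show ?thesis .
  qed
  have "AE w in path.lim. eventually (\<lambda>k. w \<in> space path.lim - ?A k) sequentially"
  proof (rule borel_cantelli_AE1)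
    show "summable (\<lambda>k. measure path.lim (?A k))"
      by (rule summable_comparison_test'[of "\<lambda>k. (1/2) ^ k"]) (use le in auto)
    show "?A k \<in> sets path.lim" for k by measurable
  qed (simp add: path.P.emeasure_eq_measure)
  then show ?thesis
  proof eventually_elim
    case (elim w)
    have "(\<lambda>k. ?D k w) \<longlonglongrightarrow> 0"
    proof (rule Lim_null_comparison)
      show "\<forall>\<^sub>F k in sequentially. norm (?D k w) \<le> (1/2) ^ k"
        using elim by eventually_elim auto
      show "(\<lambda>k. (1/2::real) ^ k) \<longlonglongrightarrow> 0" by (rule LIMSEQ_power_zero) auto
    qed
    then have "(\<lambda>k. coordinate t w - ?D k w) \<longlonglongrightarrow> coordinate t w - 0"
      by (intro tendsto_intros)
    then show ?case by simp
  qed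
qed

lemma AE_modification: "0 \<le> t \<Longrightarrow> AE w in path.lim. modification t w = coordinate t w"
  using AE_coordinate_dyadic_tendsto[of t] by (auto simp: modification_def limI)

lemma modification_0: "modification 0 w = 0"
  by (simp add: modification_def dyadic_floor_0 coordinate_def)

text \<open>Each approximant depends on time through an integer floor only; splitting over its
  countably many values reduces joint measurability to that of single coordinates, and it survives
  the limit.\<close>

lemma measurable_modification:
  "(\<lambda>(t, w). modification t w) \<in> borel_measurable (borel \<Otimes>\<^sub>M path.lim)"
proof -
  have [measurable]: "(\<lambda>x. coordinate (of_int \<lfloor>fst x * 2 ^ n\<rfloor> / 2 ^ n) (snd x))
      \<in> borel_measurable ((borel :: real measure) \<Otimes>\<^sub>M path.lim)" for n :: nat
    by (rule measurable_compose_countable[of "\<lambda>i x. coordinate (of_int i / 2 ^ n) (snd x)"])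
       measurable
  show ?thesis
    unfolding modification_def case_prod_beta dyadic_floor_def by measurable
qed

lemma measurable_modification' [measurable]: "modification t \<in> borel_measurable path.lim"
  using measurable_compose[OF measurable_Pair1' measurable_modification, of t] by simp

text \<open>Finitely many times involve finitely many null sets, so \<open>Y\<close> inherits the
  joint laws of the coordinates. The map \<open>f\<close> serves for the projections of the product
  space and for the identity.\<close>

lemma modification_process:
  assumes P: "prob_space P" and f [measurable]: "f \<in> P \<rightarrow>\<^sub>M path.lim" and distr: "distr P path.lim f = path.lim"
    and Y [measurable]: "\<And>t. Y t \<in> borel_measurable path.lim"
    and AE: "\<And>t. 0 \<le> t \<Longrightarrow> AE w in path.lim. Y t w = coordinate t w"
  shows "stationary_independent_increments P (\<lambda>t w. Y t (f w))"
    and "0 \<le> s \<Longrightarrow> distr P borel (\<lambda>w. Y s (f w)) = \<mu> s"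
proof -
  show "stationary_independent_increments P (\<lambda>t w. Y t (f w))"
  proof (rule prob_space.stationary_independent_incrementsI[OF P])
    fix n :: nat and \<tau> :: "nat \<Rightarrow> real"
    assume \<tau>: "0 \<le> \<tau> 0" "\<And>i. i < n \<Longrightarrow> \<tau> i \<le> \<tau> (Suc i)"
    have nn: "0 \<le> \<tau> i" if "i \<le> n" for i
      using that by (induction i) (auto intro: \<tau> order_trans[OF _ \<tau>(2)])
    have ae: "AE w in path.lim. \<forall>i\<in>{..n}. Y (\<tau> i) w = coordinate (\<tau> i) w"
      by (rule AE_finite_allI) (auto intro: AE nn)
    have "distr P (PiM {..<n} (\<lambda>_. borel)) (\<lambda>w. \<lambda>i\<in>{..<n}. Y (\<tau> (Suc i)) (f w) - Y (\<tau> i) (f w))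
       = distr (distr P path.lim f) (PiM {..<n} (\<lambda>_. borel)) (\<lambda>w. \<lambda>i\<in>{..<n}. Y (\<tau> (Suc i)) w - Y (\<tau> i) w)"
      by (subst distr_distr) (auto simp: comp_def)
    also have "\<dots> = distr path.lim (PiM {..<n} (\<lambda>_. borel))
        (\<lambda>w. \<lambda>i\<in>{..<n}. coordinate (\<tau> (Suc i)) w - coordinate (\<tau> i) w)"
      unfolding distr
    proof (rule distr_cong_AE)
      show "AE w in path.lim. (\<lambda>i\<in>{..<n}. Y (\<tau> (Suc i)) w - Y (\<tau> i) w)
          = (\<lambda>i\<in>{..<n}. coordinate (\<tau> (Suc i)) w - coordinate (\<tau> i) w)"
        using ae by eventually_elim (auto intro!: restrict_ext)
    qed auto
    also have "\<dots> = PiM {..<n} (\<lambda>i. \<mu> (\<tau> (Suc i) - \<tau> i))"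
      by (rule distr_path_increments[OF \<tau>])
    finally show "distr P (PiM {..<n} (\<lambda>_. borel)) (\<lambda>w. \<lambda>i\<in>{..<n}. Y (\<tau> (Suc i)) (f w) - Y (\<tau> i) (f w))
       = PiM {..<n} (\<lambda>i. \<mu> (\<tau> (Suc i) - \<tau> i))" .
  qed (auto intro: prob_space_law)
  assume s: "0 \<le> s"
  have "distr P borel (\<lambda>w. Y s (f w)) = distr (distr P path.lim f) borel (Y s)"
    by (subst distr_distr) (auto simp: comp_def)
  also have "\<dots> = distr path.lim borel (coordinate s)"
    unfolding distr by (rule distr_cong_AE) (auto intro: AE s)
  also have "\<dots> = \<mu> s"
    using distr_path_increment[of 0 s] s by (simp add: coordinate_def[of 0])
  finally show "distr P borel (\<lambda>w. Y s (f w)) = \<mu> s" .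
qed

end

section \<open>A modification with nondecreasing paths\<close>

locale nonneg_convolution_semigroup = convolution_semigroup +
  assumes law_nonneg: "AE x in \<mu> s. 0 \<le> x"
begin

text \<open>Rational times keep the event a countable intersection, hence measurable; they include
  all values of \<open>dyadic_floor\<close>.\<close>

definition monotone_paths :: "(real \<Rightarrow> real) set" where
  "monotone_paths = {w \<in> space path.lim.
     \<forall>q\<in>\<rat>. \<forall>r\<in>\<rat>. 0 \<le> q \<longrightarrow> q \<le> r \<longrightarrow> coordinate q w \<le> coordinate r w}"

lemma sets_monotone_paths [measurable]: "monotone_paths \<in> sets path.lim"
proof -
  have "Measurable.pred path.lim
    (\<lambda>w. \<forall>q\<in>\<rat>. \<forall>r\<in>\<rat>. 0 \<le> q \<longrightarrow> q \<le> r \<longrightarrow> coordinate q w \<le> coordinate r w)"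
    unfolding Measurable.pred_def
    by (intro sets.sets_Collect_countable_All' sets.sets_Collect_imp sets.sets_Collect_const countable_rat) measurable
  then show ?thesis unfolding monotone_paths_def Measurable.pred_def .
qed

lemma AE_monotone_paths: "AE w in path.lim. w \<in> monotone_paths"
proof -
  have "AE w in path.lim. coordinate q w \<le> coordinate r w" if "0 \<le> q" "q \<le> r" for q r
  proof -
    have "AE x in distr path.lim borel (\<lambda>w. coordinate r w - coordinate q w). 0 \<le> x"
      using distr_path_increment[of q "r - q"] that law_nonneg[of "r - q"] by (metis add_diff_cancel_left' add_diff_eq diff_ge_0_iff_ge)
    then have "AE w in path.lim. 0 \<le> coordinate r w - coordinate q w"
      by (rule AE_distrD[rotated]) measurable
    then show ?thesis by simp
  qed
  then have "AE w in path.lim. \<forall>q\<in>\<rat>. \<forall>r\<in>\<rat>. 0 \<le> q \<longrightarrow> q \<le> r \<longrightarrow> coordinate q w \<le> coordinate r w"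
    by (intro AE_ball_countable' AE_impI countable_rat)
  then show ?thesis unfolding monotone_paths_def by auto
qed

text \<open>\<open>directing_process\<close> asks for monotonicity at every sample point, so the
  exceptional paths are replaced by the zero path.\<close>

definition monotone_modification :: "real \<Rightarrow> (real \<Rightarrow> real) \<Rightarrow> real" where
  "monotone_modification t w = (if w \<in> monotone_paths then modification t w else 0)"

lemma measurable_monotone_modification [measurable]:
  "monotone_modification t \<in> borel_measurable path.lim"
  unfolding monotone_modification_def[abs_def] by measurable

lemma AE_monotone_modification:
  assumes "0 \<le> t"
  shows "AE w in path.lim. monotone_modification t w = coordinate t w"
  using AE_monotone_paths AE_modification[OF assms] by eventually_elim (simp add: monotone_modification_def)

lemma monotone_modification_0: "monotone_modification 0 w = 0"
  by (simp add: monotone_modification_def modification_0)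

text \<open>On a monotone path the approximants increase, as the grids refine, and are bounded by
  the value at the integer \<open>\<lceil>t\<rceil>\<close>. Thus the limit exists for all
  \<open>t \<ge> 0\<close> at once.\<close>

lemma modification_tendsto:
  assumes w: "w \<in> monotone_paths" and t: "0 \<le> t"
  shows "(\<lambda>k. coordinate (dyadic_floor (level k) t) w) \<longlonglongrightarrow> modification t w"
proof -
  have mono: "coordinate q w \<le> coordinate r w" if "q \<in> \<rat>" "r \<in> \<rat>" "0 \<le> q" "q \<le> r" for q r
    using w that by (auto simp: monotone_paths_def)
  have "incseq (\<lambda>k. coordinate (dyadic_floor (level k) t) w)"
    by (intro incseq_SucI mono dyadic_floor_Rats dyadic_floor_nonneg t dyadic_floor_refine
        monoD[OF mono_level]) simp
  moreover have "coordinate (dyadic_floor (level k) t) w \<le> coordinate (of_int \<lceil>t\<rceil>) w" for k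
    by (intro mono dyadic_floor_Rats dyadic_floor_nonneg t
        order_trans[OF dyadic_floor_le le_of_int_ceiling]) simp
  ultimately have "convergent (\<lambda>k. coordinate (dyadic_floor (level k) t) w)"
    by (metis convergentI incseq_convergent)
  then show ?thesis by (simp add: modification_def convergent_LIMSEQ_iff)
qed

text \<open>Both times are rounded down on the same grids, which preserves their order; the
  inequality passes to the limits.\<close>

lemma monotone_modification_mono:
  assumes st: "0 \<le> s" "s \<le> t"
  shows "monotone_modification s w \<le> monotone_modification t w"
proof (cases "w \<in> monotone_paths")
  case True
  have "coordinate (dyadic_floor (level k) s) w \<le> coordinate (dyadic_floor (level k) t) w" for k
    using True dyadic_floor_Rats dyadic_floor_nonneg[OF st(1)] dyadic_floor_mono[OF st(2)]
    by (auto simp: monotone_paths_def)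
  then have "modification s w \<le> modification t w"
    using st by (intro LIMSEQ_le[OF modification_tendsto modification_tendsto]) (auto intro: True)
  then show ?thesis using True by (simp add: monotone_modification_def)
qed (simp add: monotone_modification_def)

end

section \<open>Laplace transforms of nonnegative random variables\<close>

lemma real_distribution_sets: "real_distribution \<nu> \<Longrightarrow> sets \<nu> = sets borel"
  by (simp add: real_distribution_def real_distribution_axioms_def)

lemma norm_exp_Laplace_le_1: "0 \<le> Re v \<Longrightarrow> 0 \<le> x \<Longrightarrow> norm (exp (- v * complex_of_real x)) \<le> 1"
  by (simp add: norm_exp_eq_Re)

lemma (in prob_space) integrable_exp_Laplace:
  assumes [measurable]: "Z \<in> borel_measurable M" and "AE x in M. 0 \<le> Z x" "0 \<le> Re v"
  shows "integrable M (\<lambda>x. exp (- v * complex_of_real (Z x)))"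
proof (rule integrable_const_bound[where B = 1])
  show "AE x in M. norm (exp (- v * complex_of_real (Z x))) \<le> 1"
    using assms(2) by eventually_elim (rule norm_exp_Laplace_le_1[OF assms(3)])
qed measurable

lemma laplace_transform_distr:
  assumes [measurable]: "Z \<in> borel_measurable M"
  shows "laplace_transform (distr M borel Z) (\<lambda>z. z) v = laplace_transform M Z v"
  unfolding laplace_transform_def by (subst integral_distr) auto

text \<open>On \<open>[0, \<infinity>)\<close> the Laplace transform at the natural numbers lists the moments of \<open>exp (- x)\<close>, a
  bounded variable, whose characteristic function is therefore determined.\<close>

lemma laplace_transform_unique:
  assumes \<nu>: "real_distribution \<nu>" "real_distribution \<nu>'"
    and nonneg: "AE x in \<nu>. 0 \<le> x" "AE x in \<nu>'. 0 \<le> x"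
    and eq: "\<And>k::nat. laplace_transform \<nu> (\<lambda>z. z) (of_nat k) = laplace_transform \<nu>' (\<lambda>z. z) (of_nat k)"
  shows "\<nu> = \<nu>'"
proof -
  let ?D = "\<lambda>\<nu>. distr \<nu> borel (\<lambda>x::real. exp (- x))"
  \<comment> \<open>Taylor expansion of the characteristic function: as \<open>exp (- x)\<close>
    lies in \<open>[0, 1]\<close> almost everywhere, the absolute moments in the remainder are at
    most \<open>1\<close>.\<close>
  have approx: "norm (char (?D \<nu>) u - (\<Sum>k\<le>n. (\<i> * u) ^ k / fact k * laplace_transform \<nu> (\<lambda>z. z) (of_nat k)))
      \<le> 2 * \<bar>u\<bar> ^ n / fact n"
    if \<nu>: "real_distribution \<nu>" and nn: "AE x in \<nu>. 0 \<le> x" for \<nu> u n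
  proof -
    interpret real_distribution \<nu> by fact
    interpret D: real_distribution "?D \<nu>" by (rule real_distribution_distr) simp
    have AE: "AE x in \<nu>. \<bar>exp (- x) ^ k\<bar> \<le> 1" for k :: nat
      using nn by eventually_elim (simp add: power_le_one)
    have int: "integrable \<nu> (\<lambda>x. exp (- x) ^ k)" for k :: nat
      by (rule integrable_const_bound[where B = 1]) (use AE in auto)
    then have intD: "integrable (?D \<nu>) (\<lambda>x. x ^ k)" for k :: nat
      by (subst integrable_distr_eq) auto
    have mom: "complex_of_real (D.expectation (\<lambda>x. x ^ k)) = laplace_transform \<nu> (\<lambda>z. z) (of_nat k)"
      for k :: nat
    proof -
      have "complex_of_real (D.expectation (\<lambda>x. x ^ k)) = (CLINT x|\<nu>. complex_of_real (exp (- x) ^ k))"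
        by (subst integral_distr) (auto simp del: of_real_power)
      also have "\<dots> = laplace_transform \<nu> (\<lambda>z. z) (of_nat k)"
        unfolding laplace_transform_def
        by (intro Bochner_Integration.integral_cong)
           (auto simp: exp_of_real[symmetric] exp_of_nat_mult[symmetric])
      finally show ?thesis .
    qed
    have "norm (char (?D \<nu>) u - (\<Sum>k\<le>n. ((\<i> * u) ^ k / fact k) * D.expectation (\<lambda>x. x ^ k)))
        \<le> (2 * \<bar>u\<bar> ^ n / fact n) * D.expectation (\<lambda>x. \<bar>x\<bar> ^ n)"
      by (rule D.char_approx1) (rule intD)
    also have "\<dots> \<le> (2 * \<bar>u\<bar> ^ n / fact n) * 1"
    proof (rule mult_left_mono)
      have "D.expectation (\<lambda>x. \<bar>x\<bar> ^ n) = (\<integral>x. exp (- x) ^ n \<partial>\<nu>)"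
        by (subst integral_distr) auto
      also have "\<dots> \<le> (\<integral>x. 1 \<partial>\<nu>)"
        using int AE by (intro integral_mono_AE) auto
      finally show "D.expectation (\<lambda>x. \<bar>x\<bar> ^ n) \<le> 1" using prob_space by simp
    qed auto
    finally show ?thesis by (simp add: mom)
  qed
  interpret N: real_distribution \<nu> by fact
  interpret N': real_distribution \<nu>' by fact
  have "char (?D \<nu>) u = char (?D \<nu>') u" for u
  proof -
    have le: "norm (char (?D \<nu>) u - char (?D \<nu>') u) \<le> 4 * (\<bar>u\<bar> ^ n / fact n)" for n
    proof -
      let ?S = "\<Sum>k\<le>n. (\<i> * u) ^ k / fact k * laplace_transform \<nu>' (\<lambda>z. z) (of_nat k)"
      have "norm (char (?D \<nu>) u - char (?D \<nu>') u) \<le> norm (char (?D \<nu>) u - ?S) + norm (char (?D \<nu>') u - ?S)"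
        using dist_triangle2[of _ _ ?S] unfolding dist_norm .
      then show ?thesis
        using approx[OF \<nu>(1) nonneg(1), of u n] approx[OF \<nu>(2) nonneg(2), of u n]
        unfolding eq by simp
    qed
    have "(\<lambda>n. 4 * (\<bar>u\<bar> ^ n / fact n)) \<longlonglongrightarrow> 4 * 0"
      using summable_LIMSEQ_zero[OF summable_exp[of "\<bar>u\<bar>"]]
      by (intro tendsto_intros) (simp add: field_simps)
    then have "norm (char (?D \<nu>) u - char (?D \<nu>') u) \<le> 4 * 0"
      by (rule tendsto_lowerbound) (use le in auto)
    then show ?thesis by simp
  qed
  then have "?D \<nu> = ?D \<nu>'"
    by (intro Levy_uniqueness N.real_distribution_distr N'.real_distribution_distr) auto
  \<comment> \<open>The map \<open>- ln x\<close> undoes \<open>exp (- x)\<close>, so the original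
    law is an image of the transformed one.\<close>
  then have "distr (?D \<nu>) borel (\<lambda>x. - ln x) = distr (?D \<nu>') borel (\<lambda>x. - ln x)" by simp
  moreover have "distr (?D \<nu>) borel (\<lambda>x. - ln x) = \<nu>" if "real_distribution \<nu>" for \<nu>
  proof -
    have "distr (?D \<nu>) borel (\<lambda>x. - ln x) = distr \<nu> borel (\<lambda>x. x)"
      using real_distribution_sets[OF that]
      by (subst distr_distr) (auto simp: comp_def cong: measurable_cong_sets)
    also have "\<dots> = \<nu>" using real_distribution_sets[OF that] by (intro distr_id2) simp
    finally show ?thesis .
  qed
  ultimately show ?thesis using \<nu> by metis
qed

text \<open>Fubini's theorem for the factors \<open>exp (- v * x)\<close> and
  \<open>exp (- v * y)\<close>, bounded when \<open>0 \<le> Re v\<close>. The complex half-plane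
  matters: later arguments are imaginary or of the form
  \<open>- cont_log \<omega> u\<close>.\<close>

lemma laplace_transform_convolution:
  assumes \<nu>: "real_distribution \<nu>" "real_distribution \<nu>'"
    and nonneg: "AE x in \<nu>. 0 \<le> x" "AE x in \<nu>'. 0 \<le> x"
  shows "real_distribution (\<nu> \<star> \<nu>')" "AE x in \<nu> \<star> \<nu>'. 0 \<le> x"
    and "0 \<le> Re v \<Longrightarrow> laplace_transform (\<nu> \<star> \<nu>') (\<lambda>z. z) v
      = laplace_transform \<nu> (\<lambda>z. z) v * laplace_transform \<nu>' (\<lambda>z. z) v"
proof -
  interpret N: real_distribution \<nu> by fact
  interpret N': real_distribution \<nu>' by fact
  interpret P: pair_prob_space \<nu> \<nu>' ..
  show "real_distribution (\<nu> \<star> \<nu>')"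
    unfolding convolution_def by (rule P.real_distribution_distr) simp
  have "AE z in \<nu> \<Otimes>\<^sub>M \<nu>'. 0 \<le> fst z + snd z"
  proof (rule P.AE_pair_measure)
    show "AE x in \<nu>. AE y in \<nu>'. 0 \<le> fst (x, y) + snd (x, y)"
      using nonneg(1)
    proof eventually_elim
      case (elim x)
      then show ?case using nonneg(2) by auto
    qed
  qed measurable
  then show ae: "AE x in \<nu> \<star> \<nu>'. 0 \<le> x"
    unfolding convolution_def by (subst AE_distr_iff) (auto simp: case_prod_beta)
  assume v: "0 \<le> Re v"
  let ?e = "\<lambda>x. exp (- v * complex_of_real x)"
  have int: "integrable \<nu> ?e" "integrable \<nu>' ?e"
    using N.integrable_exp_Laplace[of "\<lambda>x. x" v] N'.integrable_exp_Laplace[of "\<lambda>x. x" v] v nonneg by auto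
  have "laplace_transform (\<nu> \<star> \<nu>') (\<lambda>z. z) v = (\<integral>z. ?e (fst z + snd z) \<partial>(\<nu> \<Otimes>\<^sub>M \<nu>'))"
    unfolding laplace_transform_def convolution_def by (subst integral_distr) (auto simp: case_prod_beta)
  also have "\<dots> = (\<integral>x. (\<integral>y. ?e (x + y) \<partial>\<nu>') \<partial>\<nu>)"
  proof -
    have "integrable (\<nu> \<Otimes>\<^sub>M \<nu>') (\<lambda>z. ?e (fst z + snd z))"
      using \<open>AE z in \<nu> \<Otimes>\<^sub>M \<nu>'. 0 \<le> fst z + snd z\<close> v
      by (intro P.integrable_exp_Laplace) auto
    from P.integral_fst'[OF this] show ?thesis by simp
  qed
  also have "\<dots> = (\<integral>x. ?e x * (\<integral>y. ?e y \<partial>\<nu>') \<partial>\<nu>)"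
    by (simp add: ring_distribs exp_add exp_diff divide_inverse exp_minus[symmetric])
  also have "\<dots> = laplace_transform \<nu> (\<lambda>z. z) v * laplace_transform \<nu>' (\<lambda>z. z) v"
    unfolding laplace_transform_def by simp
  finally show "laplace_transform (\<nu> \<star> \<nu>') (\<lambda>z. z) v
      = laplace_transform \<nu> (\<lambda>z. z) v * laplace_transform \<nu>' (\<lambda>z. z) v" .
qed

text \<open>The integrand is strictly positive, so its integral cannot vanish. Hence
  \<open>powr\<close> applied to such a value is an ordinary real power.\<close>

lemma (in prob_space) laplace_transform_of_real:
  assumes [measurable]: "Z \<in> borel_measurable M" and nonneg: "AE x in M. 0 \<le> Z x" and v: "0 \<le> v"
  defines "a \<equiv> expectation (\<lambda>x. exp (- v * Z x))"
  shows "laplace_transform M Z (of_real v) = of_real a" "0 < a" "a \<le> 1"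
    "integrable M (\<lambda>x. exp (- v * Z x))"
proof -
  have le: "AE x in M. exp (- v * Z x) \<le> 1"
    using nonneg by eventually_elim (use v in simp)
  show int: "integrable M (\<lambda>x. exp (- v * Z x))"
    by (rule integrable_const_bound[where B = 1]) (use le in auto)
  have "a \<le> (\<integral>x. 1 \<partial>M)"
    unfolding a_def using int le by (intro integral_mono_AE) auto
  then show "a \<le> 1" by (simp add: prob_space)
  have "0 \<le> a" unfolding a_def by simp
  moreover have "a \<noteq> 0"
  proof
    assume "a = 0"
    then have "AE x in M. exp (- v * Z x) = 0"
      unfolding a_def using int by (subst (asm) integral_nonneg_eq_0_iff_AE) auto
    then show False by (simp add: AE_False)
  qed
  ultimately show "0 < a" by simp
  have "of_real a = (CLINT x|M. complex_of_real (exp (- v * Z x)))"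
    unfolding a_def by simp
  then show "laplace_transform M Z (of_real v) = of_real a"
    by (simp add: laplace_transform_def exp_of_real[symmetric])
qed

text \<open>The left side is at most \<open>2\<close> and at most \<open>norm v * x\<close>, hence
  at most \<open>(2 + norm v) * min 1 x\<close>, while \<open>min 1 x\<close> is at most twice
  \<open>1 - exp (- x)\<close>. Integrated, this controls the transform at complex \<open>v\<close>
  by its value at \<open>1\<close>.\<close>

lemma norm_exp_Laplace_minus_1_le:
  assumes "0 \<le> Re v" "0 \<le> x"
  shows "norm (exp (- v * complex_of_real x) - 1) \<le> (4 + 2 * norm v) * (1 - exp (- x))"
proof -
  have e: "min 1 x / 2 \<le> 1 - exp (- x)"
  proof -
    have "exp (- x) * (1 + x) \<le> exp (- x) * exp x"
      by (intro mult_left_mono exp_ge_add_one_self) auto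
    then have "exp (- x) * (1 + x) \<le> 1" by (simp add: exp_minus)
    then have "exp (- x) \<le> 1 / (1 + x)" using assms by (simp add: field_simps)
    moreover have "1 / (1 + x) \<le> 1 - min 1 x / 2"
      using assms by (cases "x \<le> 1") (auto simp: field_simps min_def mult_left_le)
    ultimately show ?thesis by simp
  qed
  have b2: "norm (exp (- v * complex_of_real x) - 1) \<le> 2"
    using norm_triangle_ineq4[of "exp (- v * complex_of_real x)" 1] norm_exp_Laplace_le_1[OF assms]
    unfolding norm_one by linarith
  \<comment> \<open>Mean value bound on the half-plane \<open>Re z \<le> 0\<close>, where the
    derivative of \<open>exp\<close> has norm at most \<open>1\<close>.\<close>
  have bx: "norm (exp (- v * complex_of_real x) - 1) \<le> norm v * x"
  proof -
    let ?S = "{z. Re z \<le> 0}"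
    have "norm (exp (- v * complex_of_real x) - exp 0) \<le> 1 * norm (- v * complex_of_real x - 0)"
    proof (rule field_differentiable_bound)
      show "convex ?S" by (rule convex_halfspace_Re_le)
      show "(exp has_field_derivative exp z) (at z within ?S)" for z :: complex
        by (rule DERIV_exp[THEN has_field_derivative_at_within])
    qed (use assms in \<open>auto simp: norm_exp_eq_Re\<close>)
    then show ?thesis using assms by (simp add: norm_mult)
  qed
  have "norm (exp (- v * complex_of_real x) - 1) \<le> (2 + norm v) * min 1 x"
  proof (cases "x \<le> 1")
    case True
    have "norm v * x \<le> (2 + norm v) * x" using assms by (intro mult_right_mono) auto
    then show ?thesis using True bx by (simp add: min_def)
  next
    case False
    then show ?thesis using b2 by (simp add: min_def) (metis add.commute add_increasing norm_ge_zero)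
  qed
  also have "\<dots> = (4 + 2 * norm v) * (min 1 x / 2)" by (simp add: field_simps)
  also have "\<dots> \<le> (4 + 2 * norm v) * (1 - exp (- x))"
    using e by (intro mult_left_mono) auto
  finally show ?thesis .
qed

text \<open>Infinite divisibility prescribes transforms at real arguments only. Uniqueness turns
  their multiplicativity into a convolution identity of laws, and this carries the semigroup
  property to the whole half-plane.\<close>

lemma infinitely_divisible_lt_semigroup:
  assumes "prob_space M" and [measurable]: "Z \<in> borel_measurable M" and Z: "AE x in M. 0 \<le> Z x"
    and \<phi>: "\<phi> = laplace_transform M Z" and id: "infinitely_divisible_lt \<phi>"
  obtains \<nu> :: "real \<Rightarrow> real measure"
  where "convolution_semigroup \<nu>" "\<And>s. AE x in \<nu> s. 0 \<le> x" "\<nu> 1 = distr M borel Z"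
    "\<And>t v. 0 < t \<Longrightarrow> 0 \<le> v \<Longrightarrow> laplace_transform (\<nu> t) (\<lambda>z. z) (complex_of_real v)
      = \<phi> (complex_of_real v) powr complex_of_real t"
    "\<And>s t v. 0 \<le> s \<Longrightarrow> 0 \<le> t \<Longrightarrow> 0 \<le> Re v \<Longrightarrow> laplace_transform (\<nu> (s + t)) (\<lambda>z. z) v
      = laplace_transform (\<nu> s) (\<lambda>z. z) v * laplace_transform (\<nu> t) (\<lambda>z. z) v"
    "\<And>v. 0 \<le> Re v \<Longrightarrow> ((\<lambda>s. laplace_transform (\<nu> s) (\<lambda>z. z) v) \<longlongrightarrow> 1) (at_right 0)"
proof -
  interpret M: prob_space M by fact
  obtain \<nu>0 where \<nu>0: "\<And>t. 0 < t \<Longrightarrow> real_distribution (\<nu>0 t)" "\<And>t. 0 < t \<Longrightarrow> AE z in \<nu>0 t. 0 \<le> z"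
    "\<And>t v. 0 < t \<Longrightarrow> 0 \<le> v \<Longrightarrow> laplace_transform (\<nu>0 t) (\<lambda>z. z) (complex_of_real v)
      = \<phi> (complex_of_real v) powr complex_of_real t"
    using id unfolding infinitely_divisible_lt_def by metis
  \<comment> \<open>The point mass at \<open>0\<close> is the law at time \<open>0\<close>; at
    negative times it is a default that keeps every \<open>\<nu> t\<close> a distribution on
    nonnegative numbers.\<close>
  define \<nu> where "\<nu> t = (if 0 < t then \<nu>0 t else return borel 0)" for t
  let ?L = "\<lambda>t. laplace_transform (\<nu> t) (\<lambda>z. z)"
  have ret: "real_distribution (return borel 0)"
    by (simp add: real_distribution_def real_distribution_axioms_def prob_space_return)
  have dist: "real_distribution (\<nu> t)" for t
    using \<nu>0(1) ret by (auto simp: \<nu>_def)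
  have nonneg: "AE x in \<nu> t. 0 \<le> x" for t
  proof (cases "0 < t")
    case True
    then show ?thesis using \<nu>0(2)[OF True] unfolding \<nu>_def by simp
  next
    case False
    then have "\<nu> t = return borel 0" by (simp add: \<nu>_def)
    moreover have "AE x in return borel (0 :: real). 0 \<le> x" by (subst AE_return) auto
    ultimately show ?thesis by metis
  qed
  have L0: "?L 0 v = 1" for v
    by (simp add: \<nu>_def laplace_transform_def integral_return)
  define a where "a v = M.expectation (\<lambda>x. exp (- v * Z x))" for v
  have a: "\<phi> (complex_of_real v) = of_real (a v)" "0 < a v" if "0 \<le> v" for v
    using M.laplace_transform_of_real(1,2)[of Z v] Z that by (auto simp: \<phi> a_def)
  have L: "?L t (complex_of_real v) = of_real (a v powr t)" if "0 \<le> t" "0 \<le> v" for t v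
  proof (cases "t = 0")
    case True
    then show ?thesis using L0 a(2)[OF that(2)] by simp
  next
    case False
    then show ?thesis using \<nu>0(3)[of t v] that a[OF that(2)]
      by (simp add: \<nu>_def powr_of_real)
  qed
  have conv: "\<nu> (s + t) = (\<nu> s \<star> \<nu> t)" if "0 \<le> s" "0 \<le> t" for s t
  proof (rule laplace_transform_unique)
    fix k :: nat
    have "?L (s + t) (of_nat k) = ?L s (of_nat k) * ?L t (of_nat k)"
      using L[of "s + t" "real k"] L[of s "real k"] L[of t "real k"] that by (simp add: powr_add)
    then show "?L (s + t) (of_nat k) = laplace_transform (\<nu> s \<star> \<nu> t) (\<lambda>z. z) (of_nat k)"
      by (simp add: laplace_transform_convolution(3)[OF dist dist nonneg nonneg])
  qed (intro dist nonneg laplace_transform_convolution)+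
  have mult: "?L (s + t) v = ?L s v * ?L t v" if "0 \<le> s" "0 \<le> t" "0 \<le> Re v" for s t v
    using conv[OF that(1,2)] laplace_transform_convolution(3)[OF dist dist nonneg nonneg that(3)] by simp
  \<comment> \<open>The bound of \<open>norm_exp_Laplace_minus_1_le\<close> is integrated against
    \<open>\<nu> s\<close>, where the expectation of \<open>exp (- x)\<close> is
    \<open>a 1 powr s\<close>.\<close>
  have lim: "((\<lambda>s. ?L s v) \<longlongrightarrow> 1) (at_right 0)" if v: "0 \<le> Re v" for v
  proof -
    have bound: "norm (?L s v - 1) \<le> (4 + 2 * norm v) * (1 - a 1 powr s)" if s: "0 < s" for s
    proof -
      interpret N: real_distribution "\<nu> s" by (rule dist)
      have int: "integrable (\<nu> s) (\<lambda>x. exp (- v * complex_of_real x))"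
        using N.integrable_exp_Laplace[of "\<lambda>x. x" v] nonneg v by simp
      note r = N.laplace_transform_of_real[of "\<lambda>x. x" 1, OF _ nonneg]
      have "complex_of_real (N.expectation (\<lambda>x. exp (- x))) = complex_of_real (a 1 powr s)"
        using r(1) L[of s 1] s by simp
      then have e: "N.expectation (\<lambda>x. exp (- x)) = a 1 powr s" by (simp only: of_real_eq_iff)
      have inte: "integrable (\<nu> s) (\<lambda>x. exp (- x))" using r(4) by simp
      have "?L s v - 1 = (CLINT x|\<nu> s. exp (- v * complex_of_real x) - 1)"
        unfolding laplace_transform_def using int N.prob_space by simp
      also have "norm \<dots> \<le> (\<integral>x. norm (exp (- v * complex_of_real x) - 1) \<partial>\<nu> s)"
        by (rule integral_norm_bound)
      also have "\<dots> \<le> (\<integral>x. (4 + 2 * norm v) * (1 - exp (- x)) \<partial>\<nu> s)"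
      proof (rule integral_mono_AE)
        show "AE x in \<nu> s. norm (exp (- v * complex_of_real x) - 1) \<le> (4 + 2 * norm v) * (1 - exp (- x))"
          using nonneg by eventually_elim (rule norm_exp_Laplace_minus_1_le[OF v])
      qed (use int inte in auto)
      also have "\<dots> = (4 + 2 * norm v) * (1 - a 1 powr s)"
        using inte N.prob_space by (simp add: e)
      finally show ?thesis .
    qed
    have "((\<lambda>s. (4 + 2 * norm v) * (1 - a 1 powr s)) \<longlongrightarrow> (4 + 2 * norm v) * (1 - a 1 powr 0)) (at_right 0)"
      using a(2)[of 1] by (intro tendsto_intros) auto
    then have lim0: "((\<lambda>s. (4 + 2 * norm v) * (1 - a 1 powr s)) \<longlongrightarrow> 0) (at_right 0)"
      using a(2)[of 1] by simp
    have "((\<lambda>s. ?L s v - 1) \<longlongrightarrow> 0) (at_right 0)"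
      by (rule Lim_null_comparison[OF _ lim0])
         (auto simp: eventually_at_right_field intro: bound exI[of _ 1])
    then show ?thesis by (simp add: LIM_zero_iff)
  qed
  \<comment> \<open>Characteristic functions are transforms on the imaginary axis, so
    \<open>mult\<close> and \<open>lim\<close> yield the semigroup axioms.\<close>
  have char: "char (\<nu> s) u = ?L s (- \<i> * of_real u)" for s u
    by (simp add: char_def laplace_transform_def mult.assoc)
  show thesis
  proof (rule that[of \<nu>])
    show "convolution_semigroup \<nu>"
    proof (rule convolution_semigroup.intro)
      show "real_distribution (\<nu> s)" for s by (rule dist)
      show "\<nu> 0 = return borel 0" by (simp add: \<nu>_def)
    qed (simp_all add: char mult lim)
    show "\<nu> 1 = distr M borel Z"
    proof (rule laplace_transform_unique)
      show "real_distribution (distr M borel Z)" by simp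
      show "AE x in distr M borel Z. 0 \<le> x" using Z by (simp add: AE_distr_iff)
      show "?L 1 (of_nat k) = laplace_transform (distr M borel Z) (\<lambda>z. z) (of_nat k)" for k :: nat
        using L[of 1 "real k"] a[of "real k"] by (simp add: laplace_transform_distr \<phi>)
    qed (rule dist nonneg)+
    show "?L t (complex_of_real v) = \<phi> (complex_of_real v) powr complex_of_real t" if "0 < t" "0 \<le> v" for t v
      using \<nu>0(3)[OF that] that by (simp add: \<nu>_def)
  qed (auto intro: nonneg mult lim)
qed

text \<open>\<open>H 1\<close> is a power of \<open>H (1 / real (Suc n))\<close>, which tends to
  \<open>1\<close>, so it has no zeros. \<open>Suc n\<close> times the continuous logarithm of that
  root is a continuous logarithm of \<open>H 1\<close> vanishing at \<open>0\<close>, hence the one;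
  this settles rational exponents. Real ones are approached from above, because \<open>lim\<close>
  speaks of small positive times.\<close>

lemma multiplicative_semigroup_eq_cf_power:
  fixes H :: "real \<Rightarrow> real \<Rightarrow> complex"
  assumes add: "\<And>s t u. 0 < s \<Longrightarrow> 0 < t \<Longrightarrow> H (s + t) u = H s u * H t u"
    and cont: "\<And>t. 0 < t \<Longrightarrow> continuous_on UNIV (H t)"
    and at_0: "\<And>t. 0 < t \<Longrightarrow> H t 0 = 1"
    and lim: "\<And>u. ((\<lambda>s. H s u) \<longlongrightarrow> 1) (at_right 0)"
  shows "H 1 u \<noteq> 0" and "0 < t \<Longrightarrow> H t u = cf_power (H 1) t u"
proof -
  have pow: "H (real (Suc n) * s) u = H s u ^ Suc n" if "0 < s" for n s u
  proof (induction n)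
    case (Suc n)
    have "H (real (Suc (Suc n)) * s) u = H (real (Suc n) * s + s) u" by (simp add: algebra_simps)
    also have "\<dots> = H (real (Suc n) * s) u * H s u" using that by (intro add) auto
    finally show ?case using Suc by (simp add: mult_ac)
  qed simp
  have pow1: "H 1 u = H (1 / real (Suc n)) u ^ Suc n" for n u
    using pow[of "1 / real (Suc n)" n u] by simp
  have inv: "filterlim (\<lambda>n. 1 / real (Suc n)) (at_right 0) sequentially"
    by (intro tendsto_imp_filterlim_at_right LIMSEQ_Suc lim_1_over_n) auto
  have nz: "H 1 u \<noteq> 0" for u
  proof -
    have "(\<lambda>n. H (1 / real (Suc n)) u) \<longlonglongrightarrow> 1"
      by (rule filterlim_compose[OF lim inv])
    then have "eventually (\<lambda>n. H (1 / real (Suc n)) u \<noteq> 0) sequentially"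
      by (rule tendsto_imp_eventually_ne) simp
    then obtain n where "H (1 / real (Suc n)) u \<noteq> 0"
      by (auto simp: eventually_sequentially)
    then show ?thesis using pow1[of u n] by simp
  qed
  then show "H 1 u \<noteq> 0" .
  have root: "H (1 / real (Suc n)) u = exp (cont_log (H 1) u / of_nat (Suc n))" for n u
  proof -
    let ?G = "H (1 / real (Suc n))"
    have "?G u \<noteq> 0" for u using nz[of u] pow1[of u n] by auto
    then have G: "continuous_on UNIV (cont_log ?G)" "cont_log ?G 0 = 0" "\<And>u. exp (cont_log ?G u) = ?G u"
      by (auto intro!: cont_log_props cont at_0)
    have "cont_log (H 1) = (\<lambda>u. of_nat (Suc n) * cont_log ?G u)"
    proof (rule cont_log_eqI)
      show "exp (of_nat (Suc n) * cont_log ?G u) = H 1 u" for u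
        unfolding exp_of_nat_mult G(3) pow1[of u n] ..
    qed (intro continuous_intros G(1), simp only: G(2) mult_zero_right)
    then have "cont_log (H 1) u / of_nat (Suc n) = cont_log ?G u"
      by (simp del: of_nat_Suc)
    then show ?thesis by (simp only: G(3))
  qed
  have rat: "H (real (Suc m) / real (Suc n)) u = exp (of_real (real (Suc m) / real (Suc n)) * cont_log (H 1) u)" for m n
  proof -
    have "H (real (Suc m) / real (Suc n)) u = exp (cont_log (H 1) u / of_nat (Suc n)) ^ Suc m"
      using pow[of "1 / real (Suc n)" m u] root[of n u] by simp
    also have "\<dots> = exp (of_nat (Suc m) * (cont_log (H 1) u / of_nat (Suc n)))"
      by (rule exp_of_nat_mult[symmetric])
    finally show ?thesis by simp
  qed
  assume t: "0 < t"
  \<comment> \<open>The least multiple of \<open>1 / real (Suc n)\<close> strictly above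
    \<open>t\<close>; strictness makes \<open>r n - t\<close> a positive time, so that
    \<open>add\<close> and \<open>lim\<close> apply.\<close>
  define r where "r n = real (Suc (nat \<lfloor>t * real (Suc n)\<rfloor>)) / real (Suc n)" for n
  have r: "t < r n" "r n \<le> t + 1 / real (Suc n)" for n
  proof -
    have "real (nat \<lfloor>t * real (Suc n)\<rfloor>) = of_int \<lfloor>t * real (Suc n)\<rfloor>"
      using t by simp
    then have "t * real (Suc n) < real (Suc (nat \<lfloor>t * real (Suc n)\<rfloor>))"
      "real (Suc (nat \<lfloor>t * real (Suc n)\<rfloor>)) \<le> t * real (Suc n) + 1" by linarith+
    moreover have "t < m / k \<and> m / k \<le> t + 1 / k" if "t * k < m" "m \<le> t * k + 1" "0 < k" for m k :: real
      using that by (simp add: field_simps)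
    ultimately show "t < r n" "r n \<le> t + 1 / real (Suc n)"
      unfolding r_def by (metis of_nat_0_less_iff zero_less_Suc)+
  qed
  have r_lim: "r \<longlonglongrightarrow> t"
  proof (rule tendsto_sandwich[of "\<lambda>_. t"])
    show "(\<lambda>n. t + 1 / real (Suc n)) \<longlonglongrightarrow> t"
      using tendsto_add[OF tendsto_const[of t] LIMSEQ_Suc[OF lim_1_over_n]] by simp
  qed (use r in \<open>auto intro: less_imp_le always_eventually\<close>)
  then have "filterlim (\<lambda>n. r n - t) (at_right 0) sequentially"
    using r by (intro tendsto_imp_filterlim_at_right) (auto simp: LIM_zero_iff)
  then have "(\<lambda>n. H t u * H (r n - t) u) \<longlonglongrightarrow> H t u * 1"
    by (intro tendsto_intros filterlim_compose[OF lim])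
  moreover have "H t u * H (r n - t) u = H (r n) u" for n
    using add[of t "r n - t" u] t r(1)[of n] by simp
  ultimately have "(\<lambda>n. H (r n) u) \<longlonglongrightarrow> H t u" by simp
  moreover have "(\<lambda>n. H (r n) u) \<longlonglongrightarrow> exp (of_real t * cont_log (H 1) u)"
    unfolding r_def rat unfolding r_def[symmetric] by (intro tendsto_intros r_lim)
  ultimately show "H t u = cf_power (H 1) t u"
    unfolding cf_power_def by (rule LIMSEQ_unique)
qed

section \<open>The semigroup of an infinitely divisible characteristic function\<close>

lemma Re_cont_log_nonpos:
  assumes "infinitely_divisible_cf \<omega>"
  shows "Re (cont_log \<omega> u) \<le> 0"
proof -
  obtain \<rho> where \<rho>: "real_distribution \<rho>" "\<omega> = char \<rho>"
    using assms unfolding infinitely_divisible_cf_def is_cf_def by blast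
  interpret real_distribution \<rho> by fact
  have e: "exp (cont_log \<omega> u) = \<omega> u"
  proof (rule cont_log_props(3))
    show "continuous_on UNIV \<omega>"
      unfolding \<rho>(2) by (intro continuous_at_imp_continuous_on ballI isCont_char)
  qed (use assms in \<open>auto simp: \<rho>(2) char_zero infinitely_divisible_cf_def\<close>)
  have "exp (Re (cont_log \<omega> u)) = norm (exp (cont_log \<omega> u))" by (simp add: norm_exp_eq_Re)
  also have "\<dots> \<le> 1" using cmod_char_le_1[of u] e \<rho>(2) by simp
  finally show "Re (cont_log \<omega> u) \<le> 0" by simp
qed

lemma infinitely_divisible_cf_semigroup:
  assumes "infinitely_divisible_cf \<omega>"
  obtains \<mu> where "convolution_semigroup \<mu>" "\<And>s u. 0 \<le> s \<Longrightarrow> char (\<mu> s) u = cf_power \<omega> s u"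
proof -
  obtain \<mu>0 where \<mu>0: "\<And>s. 0 < s \<Longrightarrow> real_distribution (\<mu>0 s)" "\<And>s. 0 < s \<Longrightarrow> cf_power \<omega> s = char (\<mu>0 s)"
    using assms unfolding infinitely_divisible_cf_def is_cf_def by metis
  \<comment> \<open>At \<open>s = 0\<close> the point mass at \<open>0\<close> matches
    \<open>cf_power \<omega> 0\<close>, the constant \<open>1\<close>; negative indices get it as a
    default.\<close>
  define \<mu> where "\<mu> s = (if 0 < s then \<mu>0 s else return borel 0)" for s
  have char: "char (\<mu> s) u = cf_power \<omega> s u" if "0 \<le> s" for s u
  proof (cases "s = 0")
    case True
    then show ?thesis by (simp add: \<mu>_def cf_power_def)
  qed (use that \<mu>0(2)[of s] in \<open>simp add: \<mu>_def\<close>)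
  have "convolution_semigroup \<mu>"
  proof (rule convolution_semigroup.intro)
    show "real_distribution (\<mu> s)" for s
      using \<mu>0(1) by (simp add: \<mu>_def real_distribution_def real_distribution_axioms_def prob_space_return)
    show "\<mu> 0 = return borel 0" by (simp add: \<mu>_def)
    show "char (\<mu> (s + t)) u = char (\<mu> s) u * char (\<mu> t) u" if "0 \<le> s" "0 \<le> t" for s t u
      using that by (simp add: char cf_power_def exp_add ring_distribs)
    fix u
    have "((\<lambda>s. exp (complex_of_real s * cont_log \<omega> u)) \<longlongrightarrow> exp (complex_of_real 0 * cont_log \<omega> u)) (at_right 0)"
      by (intro tendsto_intros)
    then have "((\<lambda>s. exp (complex_of_real s * cont_log \<omega> u)) \<longlongrightarrow> 1) (at_right 0)" by simp
    then show "((\<lambda>s. char (\<mu> s) u) \<longlongrightarrow> 1) (at_right 0)"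
      by (rule Lim_transform_eventually)
         (auto simp: eventually_at_right_field char cf_power_def intro!: exI[of _ 1])
  qed
  then show thesis using that char by blast
qed

section \<open>Subordination\<close>

lemma distr_pair_snd:
  assumes "prob_space M" "prob_space N"
  shows "distr (M \<Otimes>\<^sub>M N) N snd = N"
proof (rule measure_eqI)
  interpret M: prob_space M by fact
  interpret N: prob_space N by fact
  fix A assume "A \<in> sets (distr (M \<Otimes>\<^sub>M N) N snd)"
  then have A: "A \<in> sets N" by simp
  then have "snd -` A \<inter> space (M \<Otimes>\<^sub>M N) = space M \<times> A"
    using sets.sets_into_space by (auto simp: space_pair_measure)
  then show "emeasure (distr (M \<Otimes>\<^sub>M N) N snd) A = emeasure N A"
    using A by (simp add: emeasure_distr N.emeasure_pair_measure_Times M.emeasure_space_1)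
qed simp

text \<open>\<open>cf_power h\<close> presupposes a continuous logarithm of \<open>h\<close>, so the
  absence of zeros belongs to the conclusion. \<open>infinitely_divisible_lt \<phi>\<close> is
  itself entailed by a directing process with these transforms: the laws of \<open>T t\<close> are
  witnesses.\<close>

theorem theorem2:
  fixes M :: "'a measure" and Z :: "'a \<Rightarrow> real"
    and \<phi> :: "complex \<Rightarrow> complex" and \<omega> h :: "real \<Rightarrow> complex"
  assumes "prob_space M" and "Z \<in> borel_measurable M" and "AE x in M. 0 < Z x"
    and "\<phi> = laplace_transform M Z"
    and "infinitely_divisible_lt \<phi>"
    and "infinitely_divisible_cf \<omega>"
    and "h = (\<lambda>u. \<phi> (- cont_log \<omega> u))"
  shows "(\<forall>u. h u \<noteq> 0) \<and>
    (\<exists>(P :: ((real \<Rightarrow> real) \<times> (real \<Rightarrow> real)) measure) X T.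
      prob_space P \<and>
      stationary_independent_increments P X \<and>
      (\<forall>w\<in>space P. X 0 w = 0) \<and>
      (\<forall>s>0. \<forall>u. char (distr P borel (X s)) u = cf_power \<omega> s u) \<and>
      directing_process P T \<and>
      independent_processes P X T \<and>
      (\<forall>t>0. \<forall>v\<ge>0. laplace_transform P (T t) (complex_of_real v) =
                      \<phi> (complex_of_real v) powr complex_of_real t) \<and>
      (\<forall>t>0. (\<lambda>w. X (T t w) w) \<in> borel_measurable P) \<and>
      (\<forall>t>0. \<forall>u. char (distr P borel (\<lambda>w. X (T t w) w)) u = cf_power h t u))"
proof -
  have nn: "AE x in M. 0 \<le> Z x" using assms(3) by eventually_elim simp
  obtain \<nu> where \<nu>: "convolution_semigroup \<nu>" "\<And>s. AE x in \<nu> s. 0 \<le> x" "\<nu> 1 = distr M borel Z"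
    "\<And>t v. 0 < t \<Longrightarrow> 0 \<le> v \<Longrightarrow> laplace_transform (\<nu> t) (\<lambda>z. z) (complex_of_real v)
      = \<phi> (complex_of_real v) powr complex_of_real t"
    "\<And>s t v. 0 \<le> s \<Longrightarrow> 0 \<le> t \<Longrightarrow> 0 \<le> Re v \<Longrightarrow> laplace_transform (\<nu> (s + t)) (\<lambda>z. z) v
      = laplace_transform (\<nu> s) (\<lambda>z. z) v * laplace_transform (\<nu> t) (\<lambda>z. z) v"
    "\<And>v. 0 \<le> Re v \<Longrightarrow> ((\<lambda>s. laplace_transform (\<nu> s) (\<lambda>z. z) v) \<longlongrightarrow> 1) (at_right 0)"
    by (rule infinitely_divisible_lt_semigroup[OF assms(1,2) nn assms(4,5)]) (use that in blast)
  obtain \<mu> where \<mu>: "convolution_semigroup \<mu>" "\<And>s u. 0 \<le> s \<Longrightarrow> char (\<mu> s) u = cf_power \<omega> s u"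
    by (rule infinitely_divisible_cf_semigroup[OF assms(6)]) (use that in blast)
  \<comment> \<open>Places \<open>- cont_log \<omega> u\<close> in the half-plane where the
    transforms of the \<open>\<nu> t\<close> are bounded and multiplicative.\<close>
  have Re_log: "0 \<le> Re (- cont_log \<omega> u)" for u
    using Re_cont_log_nonpos[OF assms(6)] by simp
  interpret X: convolution_semigroup \<mu> by fact
  interpret T: nonneg_convolution_semigroup \<nu>
    by (intro nonneg_convolution_semigroup.intro nonneg_convolution_semigroup_axioms.intro \<nu>(1,2))
  define P where "P = X.path.lim \<Otimes>\<^sub>M T.path.lim"
  interpret P: pair_prob_space X.path.lim T.path.lim ..
  have prob: "prob_space P" unfolding P_def by (rule P.prob_space_axioms)
  have fst: "fst \<in> P \<rightarrow>\<^sub>M X.path.lim" "distr P X.path.lim fst = X.path.lim"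
    and snd: "snd \<in> P \<rightarrow>\<^sub>M T.path.lim" "distr P T.path.lim snd = T.path.lim"
    unfolding P_def
    by (simp_all add: T.path.P.distr_pair_fst distr_pair_snd X.path.P.prob_space_axioms T.path.P.prob_space_axioms)
  define X where "X t w = X.modification t (fst w)" for t and w :: "(real \<Rightarrow> real) \<times> (real \<Rightarrow> real)"
  define T where "T t w = T.monotone_modification t (snd w)" for t and w :: "(real \<Rightarrow> real) \<times> (real \<Rightarrow> real)"
  note X_process = X.modification_process[OF prob fst X.measurable_modification' X.AE_modification,
      folded X_def]
  note T_process = T.modification_process[OF prob snd T.measurable_monotone_modification
      T.AE_monotone_modification, folded T_def]
  have [measurable]: "X t \<in> borel_measurable P" "T t \<in> borel_measurable P" for t
    using fst(1) snd(1) unfolding X_def[abs_def] T_def[abs_def] by measurable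
  have indep: "independent_processes P X T"
  proof -
    \<comment> \<open>The two projections are independent by construction of \<open>P\<close>; each
      process is a measurable function of one of them.\<close>
    have "prob_space.indep_var P X.path.lim fst T.path.lim snd"
      unfolding prob_space.indep_var_distribution_eq[OF prob]
      using fst snd by (simp add: P_def[symmetric] distr_id2)
    then have "prob_space.indep_var P
       (PiM {0..} (\<lambda>_. borel)) ((\<lambda>w. \<lambda>t\<in>{0..}. X.modification t w) \<circ> fst)
       (PiM {0..} (\<lambda>_. borel)) ((\<lambda>w. \<lambda>t\<in>{0..}. T.monotone_modification t w) \<circ> snd)"
      by (rule prob_space.indep_var_compose[OF prob]) (intro measurable_restrict; measurable)+
    then show ?thesis
      by (simp add: independent_processes_def comp_def X_def T_def)
  qed
  \<comment> \<open>A random time is inserted, so measurability at fixed times does not suffice;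
    joint measurability in time and path is used.\<close>
  have mXT: "(\<lambda>w. X (T t w) w) \<in> borel_measurable P" for t
  proof -
    have "(\<lambda>w. (T t w, fst w)) \<in> P \<rightarrow>\<^sub>M borel \<Otimes>\<^sub>M X.path.lim" using fst(1) by measurable
    from measurable_compose[OF this X.measurable_modification] show ?thesis by (simp add: X_def)
  qed
  have T_nonneg: "0 \<le> T.monotone_modification t w" if "0 \<le> t" for t w
    using T.monotone_modification_mono[of 0 t w] that by (simp add: T.monotone_modification_0)
  have XT: "char (distr P borel (\<lambda>w. X (T t w) w)) u = laplace_transform (\<nu> t) (\<lambda>z. z) (- cont_log \<omega> u)"
    if t: "0 < t" for t u
  proof -
    have "char (distr P borel (\<lambda>w. X (T t w) w)) u = (CLINT w|P. iexp (u * X (T t w) w))"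
      using mXT by (simp add: char_def integral_distr)
    also have "\<dots> = (CLINT y|T.path.lim. (CLINT x|X.path.lim.
        iexp (u * X.modification (T.monotone_modification t y) x)))"
    proof -
      have "integrable P (\<lambda>w. iexp (u * X (T t w) w))"
        using mXT by (intro prob_space.integrable_iexp[OF prob]) auto
      then have "integrable (X.path.lim \<Otimes>\<^sub>M T.path.lim)
         (\<lambda>(x, y). iexp (u * X.modification (T.monotone_modification t y) x))"
        by (simp add: P_def X_def T_def split_beta')
      from P.integral_snd[OF this] show ?thesis
        by (simp add: P_def X_def T_def split_beta')
    qed
    \<comment> \<open>With the path \<open>y\<close> of the directing process frozen, the time is a
      fixed number \<open>?s \<ge> 0\<close>, at which the inner integral is the characteristic
      function of \<open>\<mu> ?s\<close>.\<close>
    also have "\<dots> = (CLINT y|T.path.lim. exp (- (- cont_log \<omega> u) * complex_of_real (T.monotone_modification t y)))"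
    proof (intro Bochner_Integration.integral_cong refl)
      fix y
      let ?s = "T.monotone_modification t y"
      have s: "0 \<le> ?s" using T_nonneg t by simp
      have "(CLINT x|X.path.lim. iexp (u * X.modification ?s x)) = char (distr X.path.lim borel (X.modification ?s)) u"
        by (simp add: char_def integral_distr)
      also have "distr X.path.lim borel (X.modification ?s) = \<mu> ?s"
        using X.modification_process(2)[OF X.path.P.prob_space_axioms measurable_ident_sets[OF refl] distr_id2[OF refl]
            X.measurable_modification' X.AE_modification s] by simp
      finally show "(CLINT x|X.path.lim. iexp (u * X.modification ?s x))
        = exp (- (- cont_log \<omega> u) * complex_of_real ?s)"
        using \<mu>(2)[OF s] by (simp add: cf_power_def mult.commute)
    qed
    also have "\<dots> = laplace_transform T.path.lim (T.monotone_modification t) (- cont_log \<omega> u)"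
      by (simp add: laplace_transform_def)
    also have "\<dots> = laplace_transform (distr T.path.lim borel (T.monotone_modification t)) (\<lambda>z. z) (- cont_log \<omega> u)"
      by (rule laplace_transform_distr[symmetric]) measurable
    also have "distr T.path.lim borel (T.monotone_modification t) = \<nu> t"
      using T.modification_process(2)[OF T.path.P.prob_space_axioms measurable_ident_sets[OF refl] distr_id2[OF refl]
          T.measurable_monotone_modification T.AE_monotone_modification, of t] t by simp
    finally show ?thesis .
  qed
  \<comment> \<open>Two readings of \<open>H\<close>: as a transform of \<open>\<nu> t\<close> it is
    multiplicative in \<open>t\<close>, and for \<open>t > 0\<close> it is a characteristic function
    in \<open>u\<close>, hence continuous with value \<open>1\<close> at \<open>0\<close>. At
    \<open>t = 1\<close> it is \<open>h\<close>, since \<open>\<nu> 1\<close> is the law of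
    \<open>Z\<close>.\<close>
  define H where "H t u = laplace_transform (\<nu> t) (\<lambda>z. z) (- cont_log \<omega> u)" for t u
  have H_char: "H t = char (distr P borel (\<lambda>w. X (T t w) w))" if "0 < t" for t
    using XT[OF that] by (simp add: H_def fun_eq_iff)
  have dXT: "real_distribution (distr P borel (\<lambda>w. X (T t w) w))" for t
    using prob_space.real_distribution_distr[OF prob mXT] .
  have H1: "H 1 = h"
    by (simp add: H_def fun_eq_iff \<nu>(3) laplace_transform_distr[OF assms(2)] assms(4,7))
  have H_add: "H (s + t) u = H s u * H t u" if "0 < s" "0 < t" for s t u
    unfolding H_def using that Re_log by (intro \<nu>(5)) auto
  have H_cont: "continuous_on UNIV (H t)" if "0 < t" for t
    unfolding H_char[OF that]
    by (intro continuous_at_imp_continuous_on ballI real_distribution.isCont_char dXT)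
  have H_0: "H t 0 = 1" if "0 < t" for t
    unfolding H_char[OF that] by (rule real_distribution.char_zero[OF dXT])
  have H_lim: "((\<lambda>s. H s u) \<longlongrightarrow> 1) (at_right 0)" for u
    unfolding H_def by (rule \<nu>(6)[OF Re_log])
  have h_nonzero: "h u \<noteq> 0" for u
    using multiplicative_semigroup_eq_cf_power(1)[of H u] H_add H_cont H_0 H_lim by (simp add: H1)
  have H_power: "H t u = cf_power h t u" if "0 < t" for t u
    using multiplicative_semigroup_eq_cf_power(2)[of H t u] H_add H_cont H_0 H_lim that by (simp add: H1)
  show ?thesis
  proof (rule conjI, intro allI, rule h_nonzero,
      rule exI[of _ P], rule exI[of _ X], rule exI[of _ T], intro conjI allI impI ballI)
    show "prob_space P" by (rule prob)
    show "stationary_independent_increments P X" by (rule X_process(1))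
    show "X 0 w = 0" for w by (simp add: X_def X.modification_0)
    show "char (distr P borel (X s)) u = cf_power \<omega> s u" if "0 < s" for s u
      using X_process(2)[of s] \<mu>(2)[of s u] that by simp
    show "directing_process P T"
      unfolding directing_process_def
    proof (intro conjI ballI allI impI)
      show "stationary_independent_increments P T" by (rule T_process(1))
    qed (simp_all add: T_def T.monotone_modification_0 T.monotone_modification_mono)
    show "independent_processes P X T" by (rule indep)
    show "laplace_transform P (T t) (complex_of_real v) = \<phi> (complex_of_real v) powr complex_of_real t"
      if "0 < t" "0 \<le> v" for t v
      using \<nu>(4)[OF that] T_process(2)[of t] that laplace_transform_distr[of "T t" P] by simp
    show "(\<lambda>w. X (T t w) w) \<in> borel_measurable P" for t by (rule mXT)
    show "char (distr P borel (\<lambda>w. X (T t w) w)) u = cf_power h t u" if "0 < t" for t u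
      using H_power[OF that, of u] XT[OF that] by (simp add: H_def)
  qed
qed

end
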